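(* Let $L\subset\mathbb{R}^3$ be the point lattice of the densest lattice packing $\{B^3+x\mid x\in L\}$ of closed unit balls in $\mathbb{R}^3$. Then there exists no both-way infinite open circular cylinder with radius of base $r>3\sqrt2/4-1$ that is disjoint to $\bigcup\{B^3+x\mid x\in L\}$. That is, the value $3\sqrt2/4-1$ is sharp in the following theorem, even when stated for one cylinder only: for each lattice packing of closed unit balls in $\mathbb{R}^3$ there exist three both-way infinite open circular cylinders with linearly independent directions of axes, disjoint to the union of the balls of the lattice packing, with radii of their bases $3\sqrt2/4-1$.
   Context: $B^3\subset\mathbb{R}^3$ is the closed unit ball centred at $0$. $\{B^3+x\mid x\in L\}$ is a lattice packing if $L$ is a lattice (of full rank) and the balls have pairwise disjoint interiors. The lattice of the densest lattice packing of unit balls in $\mathbb{R}^3$ is, up to congruence, the one generated by $\sqrt2(0,1,1),\sqrt2(1,0,1),\sqrt2(1,1,0)$ (the face-centred cubic lattice with minimal vector length $2$). A both-way infinite open circular cylinder with radius of base $r$ is the set of points of $\mathbb{R}^3$ at distance less than $r$ from some straight line (its axis). *)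

theory Defs
  imports "HOL-Analysis.Analysis"
begin

text \<open>A basis of a full-rank lattice is represented by the rows of an invertible matrix.\<close>

definition lattice_basis :: "real^3^3 \<Rightarrow> (real^3) set \<Rightarrow> bool" where
  "lattice_basis B L \<longleftrightarrow>
     invertible B \<and> L = range (\<lambda>z :: int^3. \<Sum>i\<in>UNIV. of_int (z $ i) *\<^sub>R row i B)"

definition is_lattice :: "(real^3) set \<Rightarrow> bool" where
  "is_lattice L \<longleftrightarrow> (\<exists>B. lattice_basis B L)"

text \<open>The volume of a fundamental parallelepiped; it does not depend on the chosen basis,
  see \<open>lattice_det_eq\<close> below.\<close>

definition lattice_det :: "(real^3) set \<Rightarrow> real" where
  "lattice_det L = \<bar>det (SOME B. lattice_basis B L)\<bar>"

definition lattice_packing :: "(real^3) set \<Rightarrow> bool" where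
  "lattice_packing L \<longleftrightarrow> is_lattice L \<and>
     (\<forall>x\<in>L. \<forall>y\<in>L. x \<noteq> y \<longrightarrow> interior (cball x 1) \<inter> interior (cball y 1) = {})"

definition packing_density :: "(real^3) set \<Rightarrow> real" where
  "packing_density L = measure lebesgue (cball (0 :: real^3) 1) / lattice_det L"

definition densest_lattice_packing :: "(real^3) set \<Rightarrow> bool" where
  "densest_lattice_packing L \<longleftrightarrow> lattice_packing L \<and>
     (\<forall>M. lattice_packing M \<longrightarrow> packing_density M \<le> packing_density L)"

definition ball_union :: "(real^3) set \<Rightarrow> (real^3) set" where
  "ball_union L = (\<Union>x\<in>L. cball x 1)"

definition axis_line :: "real^3 \<Rightarrow> real^3 \<Rightarrow> (real^3) set" where
  "axis_line p u = range (\<lambda>t :: real. p + t *\<^sub>R u)"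

text \<open>This is a cylinder only for \<open>u \<noteq> 0\<close>.\<close>

definition open_cylinder :: "real^3 \<Rightarrow> real^3 \<Rightarrow> real \<Rightarrow> (real^3) set" where
  "open_cylinder p u r = {x. infdist x (axis_line p u) < r}"

definition has_free_cylinder :: "(real^3) set \<Rightarrow> real \<Rightarrow> bool" where
  "has_free_cylinder L r \<longleftrightarrow> (\<exists>p u. u \<noteq> 0 \<and> open_cylinder p u r \<inter> ball_union L = {})"

definition has_three_free_cylinders :: "(real^3) set \<Rightarrow> real \<Rightarrow> bool" where
  "has_three_free_cylinders L r \<longleftrightarrow>
     (\<exists>p1 p2 p3 u1 u2 u3. distinct [u1, u2, u3] \<and> independent {u1, u2, u3} \<and>
        open_cylinder p1 u1 r \<inter> ball_union L = {} \<and>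
        open_cylinder p2 u2 r \<inter> ball_union L = {} \<and>
        open_cylinder p3 u3 r \<inter> ball_union L = {})"

lemma lattice_basis_det_dvd:
  assumes "lattice_basis B L" "lattice_basis C L"
  shows "\<exists>k :: int. det C = of_int k * det B"
proof -
  have "\<exists>z :: int^3. row j C = (\<Sum>i\<in>UNIV. of_int (z $ i) *\<^sub>R row i B)" for j
  proof -
    have "row j C = (\<Sum>i\<in>UNIV. of_int ((\<chi> i. if i = j then 1 else 0 :: int^3) $ i) *\<^sub>R row i C)"
      by (simp add: if_distrib [of of_int] if_distrib [of "\<lambda>c. c *\<^sub>R _"] cong: if_cong)
    then have "row j C \<in> L"
      using assms(2) unfolding lattice_basis_def by blast
    then show ?thesis
      using assms(1) unfolding lattice_basis_def by blast
  qed
  then obtain z :: "3 \<Rightarrow> int^3"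
    where z: "\<And>j. row j C = (\<Sum>i\<in>UNIV. of_int (z j $ i) *\<^sub>R row i B)"
    by metis
  define P :: "real^3^3" where "P = (\<chi> j i. of_int (z j $ i))"
  have "C = P ** B"
  proof -
    have "C $ j $ k = (P ** B) $ j $ k" for j k
      using arg_cong [OF z [of j], of "\<lambda>v. v $ k"]
      by (simp add: row_def P_def matrix_matrix_mult_def)
    then show ?thesis by (simp add: vec_eq_iff)
  qed
  moreover have "det P = of_int (det (\<chi> j i. z j $ i :: int^3^3))"
    by (simp add: det_3 P_def)
  ultimately show ?thesis
    by (auto simp: det_mul)
qed

lemma lattice_det_eq:
  assumes B: "lattice_basis B L"
  shows "lattice_det L = \<bar>det B\<bar>"
proof -
  define C where "C = (SOME C. lattice_basis C L)"
  have C: "lattice_basis C L"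
    unfolding C_def using B by (rule someI)
  obtain k l :: int where k: "det C = of_int k * det B" and l: "det B = of_int l * det C"
    using lattice_basis_det_dvd B C by meson
  have "det B \<noteq> 0"
    using B by (simp add: lattice_basis_def invertible_det_nz)
  moreover have "det B * of_int (l * k) = det B * 1"
    using l unfolding k by (simp only: of_int_mult mult_ac mult_1_right)
  ultimately have "of_int (l * k) = (1 :: real)"
    by (simp only: mult_cancel_left) simp
  then have "l * k = 1"
    by (simp only: of_int_eq_1_iff)
  then have "\<bar>k\<bar> = 1"
    by (auto simp: zmult_eq_1_iff)
  then have "\<bar>of_int k :: real\<bar> = 1"
    by linarith
  then show ?thesis
    using k by (simp add: lattice_det_def C_def [symmetric] abs_mult)
qed

end

theory Submission imports Defs begin

text \<open>
  A cylinder of radius \<open>r\<close> about a line misses all unit balls iff the line has distance at least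
  \<open>1 + r\<close> from every lattice point, and \<open>(1 + r)\<^sup>2 = 9/8\<close> at the critical radius. Everything is read
  off a basis of \<open>L\<close> minimising the sum of the squared lengths. Projecting along one of its vectors \<open>d\<close>
  gives a planar lattice with an obtuse superbase, hence a nonobtuse Delaunay triangle.

  \<^item> The line through the circumcentre of this triangle in direction \<open>d\<close> is far from \<open>L\<close>. The three basis
    vectors give the three cylinders.
  \<^item> For a shortest \<open>d\<close>, the area of the triangle is bounded below by Heron's formula. This is Gauss'
    theorem \<open>(det L)\<^sup>2 \<ge> 32\<close>, and the case of equality forces \<open>L\<close> to be face-centred cubic.
  \<^item> In the face-centred cubic lattice, put \<open>u1 \<ge> u2 \<ge> u3 \<ge> 0\<close> for the coordinates of the direction of
    a line. The line meets a lattice triangle with edges \<open>\<surd>2(0,1,1)\<close> and \<open>\<surd>2(1,0,1)\<close>, and by Leibniz'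
    formula its squared distance from one of the three vertices is at most \<open>9/8\<close>.
\<close>

section \<open>Lattice bases\<close>

definition det3 :: "real^3 \<Rightarrow> real^3 \<Rightarrow> real^3 \<Rightarrow> real" where
  "det3 a b c = det (vector [a, b, c] :: real^3^3)"

definition int_span :: "real^3 \<Rightarrow> real^3 \<Rightarrow> real^3 \<Rightarrow> (real^3) set" where
  "int_span a b c = {of_int i *\<^sub>R a + of_int j *\<^sub>R b + of_int k *\<^sub>R c | i j k :: int. True}"

text \<open>Bases are handled as three separate vectors, so that rotations, sign changes and shears
  act on single vectors instead of on a matrix.\<close>

definition basis_of :: "(real^3) set \<Rightarrow> real^3 \<Rightarrow> real^3 \<Rightarrow> real^3 \<Rightarrow> bool" where
  "basis_of L a b c \<longleftrightarrow> L = int_span a b c \<and> det3 a b c \<noteq> 0"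

lemma det3_eq:
  "det3 a b c = a$1 * b$2 * c$3 + a$2 * b$3 * c$1 + a$3 * b$1 * c$2
     - a$1 * b$3 * c$2 - a$2 * b$1 * c$3 - a$3 * b$2 * c$1"
  by (simp add: det3_def det_3 vector_3)

lemma inner_3: "(x :: real^3) \<bullet> y = x$1 * y$1 + x$2 * y$2 + x$3 * y$3"
  by (simp add: inner_vec_def sum_3)

lemma lattice_basis_iff: "lattice_basis B L \<longleftrightarrow> basis_of L (row 1 B) (row 2 B) (row 3 B)"
proof -
  have "range (\<lambda>z :: int^3. \<Sum>i\<in>UNIV. of_int (z $ i) *\<^sub>R row i B)
      = int_span (row 1 B) (row 2 B) (row 3 B)" (is "?l = ?r")
  proof
    show "?l \<subseteq> ?r" by (force simp: int_span_def sum_3)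
    show "?r \<subseteq> ?l"
    proof
      fix x assume "x \<in> ?r"
      then obtain i j k :: int
        where "x = of_int i *\<^sub>R row 1 B + of_int j *\<^sub>R row 2 B + of_int k *\<^sub>R row 3 B"
        by (auto simp: int_span_def)
      then have "x = (\<Sum>l\<in>UNIV. of_int ((vector [i, j, k] :: int^3) $ l) *\<^sub>R row l B)"
        by (simp add: sum_3 vector_3)
      then show "x \<in> ?l" by blast
    qed
  qed
  moreover have "det3 (row 1 B) (row 2 B) (row 3 B) = det B"
    by (simp add: det3_eq det_3 row_def)
  ultimately show ?thesis
    by (auto simp add: lattice_basis_def basis_of_def invertible_det_nz)
qed

lemma basis_of_lattice_basis: "basis_of L a b c \<Longrightarrow> lattice_basis (vector [a, b, c]) L"
  by (simp add: lattice_basis_iff row_def vector_3 vec_lambda_eta)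

lemma basis_of_det: "basis_of L a b c \<Longrightarrow> lattice_det L = \<bar>det3 a b c\<bar>"
  by (simp add: det3_def lattice_det_eq basis_of_lattice_basis)

text \<open>The right-hand side is the Gram determinant of the three vectors.\<close>

lemma det3_square:
  "(det3 a b c)\<^sup>2 = (a \<bullet> a) * (b \<bullet> b) * (c \<bullet> c) + 2 * (a \<bullet> b) * (b \<bullet> c) * (a \<bullet> c)
     - (a \<bullet> a) * (b \<bullet> c)\<^sup>2 - (b \<bullet> b) * (a \<bullet> c)\<^sup>2 - (c \<bullet> c) * (a \<bullet> b)\<^sup>2"
  unfolding det3_eq inner_3 by algebra

lemma basis_of_rotate: "basis_of L a b c \<Longrightarrow> basis_of L b c a"
proof -
  have sub: "int_span a b c \<subseteq> int_span b c a" for a b c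
  proof
    fix x assume "x \<in> int_span a b c"
    then obtain i j k :: int where "x = of_int i *\<^sub>R a + of_int j *\<^sub>R b + of_int k *\<^sub>R c"
      by (auto simp: int_span_def)
    then have "x = of_int j *\<^sub>R b + of_int k *\<^sub>R c + of_int i *\<^sub>R a" by simp
    then show "x \<in> int_span b c a" unfolding int_span_def by blast
  qed
  then have "int_span a b c = int_span b c a" by (meson subset_antisym order_trans)
  moreover have "det3 b c a = det3 a b c"
    by (simp add: det3_eq)
  ultimately show "basis_of L a b c \<Longrightarrow> basis_of L b c a"
    by (auto simp: basis_of_def)
qed

lemma basis_of_shear:
  fixes s t :: int
  assumes "basis_of L a b c"
  shows "basis_of L (a + of_int s *\<^sub>R b + of_int t *\<^sub>R c) b c"
proof -
  have sub: "int_span (a + of_int s *\<^sub>R b + of_int t *\<^sub>R c) b c \<subseteq> int_span a b c" for a and s t :: int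
  proof
    fix x assume "x \<in> int_span (a + of_int s *\<^sub>R b + of_int t *\<^sub>R c) b c"
    then obtain i j k :: int
      where "x = of_int i *\<^sub>R (a + of_int s *\<^sub>R b + of_int t *\<^sub>R c) + of_int j *\<^sub>R b + of_int k *\<^sub>R c"
      by (auto simp: int_span_def)
    then have "x = of_int i *\<^sub>R a + of_int (i * s + j) *\<^sub>R b + of_int (i * t + k) *\<^sub>R c"
      by (simp add: algebra_simps)
    then show "x \<in> int_span a b c" unfolding int_span_def by blast
  qed
  \<comment> \<open>The opposite shear restores \<open>a\<close>, which gives the reverse
    inclusion.\<close>
  have "int_span a b c \<subseteq> int_span (a + of_int s *\<^sub>R b + of_int t *\<^sub>R c) b c"
    using sub[of "a + of_int s *\<^sub>R b + of_int t *\<^sub>R c" "- s" "- t"] by (simp add: algebra_simps)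
  moreover have "det3 (a + of_int s *\<^sub>R b + of_int t *\<^sub>R c) b c = det3 a b c"
    by (simp add: det3_eq algebra_simps)
  ultimately show ?thesis
    using assms sub[of a s t] by (auto simp: basis_of_def)
qed

lemma basis_of_uminus: "basis_of L a b c \<Longrightarrow> basis_of L (- a) b c"
proof -
  have sub: "int_span (- a) b c \<subseteq> int_span a b c" for a
  proof
    fix x assume "x \<in> int_span (- a) b c"
    then obtain i j k :: int where "x = of_int i *\<^sub>R (- a) + of_int j *\<^sub>R b + of_int k *\<^sub>R c"
      by (auto simp: int_span_def)
    then have "x = of_int (- i) *\<^sub>R a + of_int j *\<^sub>R b + of_int k *\<^sub>R c" by simp
    then show "x \<in> int_span a b c" unfolding int_span_def by blast
  qed
  have "int_span (- a) b c = int_span a b c"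
    using sub[of a] sub[of "- a"] by simp
  moreover have "det3 (- a) b c = - det3 a b c"
    by (simp add: det3_eq)
  ultimately show "basis_of L a b c \<Longrightarrow> basis_of L (- a) b c"
    by (auto simp: basis_of_def)
qed

lemma basis_of_mem: 
  assumes "basis_of L a b c" shows "of_int i *\<^sub>R a + of_int j *\<^sub>R b + of_int k *\<^sub>R c \<in> L"
  using assms unfolding basis_of_def int_span_def by blast

lemma basis_of_members:
  assumes "basis_of L a b c" shows "a \<in> L" "b \<in> L" "c \<in> L"
  using basis_of_mem[OF assms, of 1 0 0] basis_of_mem[OF assms, of 0 1 0]
    basis_of_mem[OF assms, of 0 0 1] by simp_all

lemma basis_of_nonzero:
  assumes "basis_of L a b c" shows "a \<noteq> 0" "b \<noteq> 0" "c \<noteq> 0"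
  using assms by (auto simp: basis_of_def det3_eq)

lemma basis_of_diff:
  assumes "basis_of L a b c" "x \<in> L" "y \<in> L" shows "x - y \<in> L"
proof -
  obtain i j k i' j' k' :: int where "x = of_int i *\<^sub>R a + of_int j *\<^sub>R b + of_int k *\<^sub>R c"
    and "y = of_int i' *\<^sub>R a + of_int j' *\<^sub>R b + of_int k' *\<^sub>R c"
    using assms by (auto simp: basis_of_def int_span_def)
  then have "x - y = of_int (i - i') *\<^sub>R a + of_int (j - j') *\<^sub>R b + of_int (k - k') *\<^sub>R c"
    by (simp add: algebra_simps)
  then show ?thesis using basis_of_mem[OF assms(1)] by metis
qed

lemma basis_of_independent:
  assumes "basis_of L a b c"
  shows "distinct [a, b, c]" "independent {a, b, c}"
proof -
  have "det (vector [a, b, c] :: real^3^3) \<noteq> 0"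
    using assms by (simp add: basis_of_def det3_def)
  moreover have "rows (vector [a, b, c] :: real^3^3)
      = (\<lambda>i. row i (vector [a, b, c] :: real^3^3)) ` {1, 2, 3}"
    unfolding rows_def using UNIV_3 by auto
  then have "rows (vector [a, b, c] :: real^3^3) = {a, b, c}"
    by (simp add: row_def vec_lambda_eta)
  ultimately show "independent {a, b, c}"
    using det_dependent_rows[of "vector [a, b, c] :: real^3^3"] by (auto simp: dependent_vec_eq)
  show "distinct [a, b, c]"
    using assms by (auto simp: basis_of_def det3_eq)
qed

section \<open>Reduced bases\<close>

text \<open>If \<open>x\<close> were shorter than 2, the midpoint of \<open>0\<close> and
  \<open>x\<close> would be interior to both unit balls.\<close>

lemma lattice_packing_min_norm:
  assumes "lattice_packing L" "x \<in> L" "x \<noteq> 0"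
  shows "4 \<le> x \<bullet> x"
proof (rule ccontr)
  assume "\<not> 4 \<le> x \<bullet> x"
  then have "(norm x)\<^sup>2 < 2\<^sup>2" by (simp add: power2_norm_eq_inner)
  then have n: "norm x < 2" by (rule power2_less_imp_less) simp
  obtain B where B: "lattice_basis B L" using assms by (auto simp: lattice_packing_def is_lattice_def)
  have "x - x \<in> L"
    using B assms basis_of_diff unfolding lattice_basis_iff by blast
  then have "interior (cball x 1) \<inter> interior (cball (0 :: real^3) 1) = {}"
    using assms unfolding lattice_packing_def by simp
  moreover have "x /\<^sub>R 2 \<in> interior (cball x 1) \<inter> interior (cball 0 1)"
  proof -
    have "x - x /\<^sub>R 2 = x /\<^sub>R 2"
      by (simp add: vec_eq_iff)
    then have "dist x (x /\<^sub>R 2) < 1" using n by (simp only: dist_norm) simp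
    then show ?thesis using n by (simp add: dist_norm)
  qed
  ultimately show False by blast
qed

text \<open>The reduction inequalities used later all come from these nine comparisons.\<close>

definition shortest_mod :: "real^3 \<Rightarrow> real^3 \<Rightarrow> real^3 \<Rightarrow> bool" where
  "shortest_mod a b c \<longleftrightarrow>
     (\<forall>s t :: int. \<bar>s\<bar> \<le> 1 \<longrightarrow> \<bar>t\<bar> \<le> 1 \<longrightarrow>
        a \<bullet> a \<le> (a + of_int s *\<^sub>R b + of_int t *\<^sub>R c) \<bullet> (a + of_int s *\<^sub>R b + of_int t *\<^sub>R c))"

definition reduced_triple :: "real^3 \<Rightarrow> real^3 \<Rightarrow> real^3 \<Rightarrow> bool" where
  "reduced_triple a b c \<longleftrightarrow> shortest_mod a b c \<and> shortest_mod b c a \<and> shortest_mod c a b"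

lemma shortest_mod_swap: "shortest_mod a b c \<Longrightarrow> shortest_mod a c b"
  unfolding shortest_mod_def
proof (intro allI impI)
  fix s t :: int
  assume *: "\<forall>s t :: int. \<bar>s\<bar> \<le> 1 \<longrightarrow> \<bar>t\<bar> \<le> 1 \<longrightarrow>
        a \<bullet> a \<le> (a + of_int s *\<^sub>R b + of_int t *\<^sub>R c) \<bullet> (a + of_int s *\<^sub>R b + of_int t *\<^sub>R c)"
    and "\<bar>s\<bar> \<le> 1" "\<bar>t\<bar> \<le> 1"
  then show "a \<bullet> a \<le> (a + of_int s *\<^sub>R c + of_int t *\<^sub>R b) \<bullet> (a + of_int s *\<^sub>R c + of_int t *\<^sub>R b)"
    using *[rule_format, of t s] by (simp only: add_ac)
qed

lemma shortest_mod_uminus: "shortest_mod a b c \<Longrightarrow> shortest_mod a (- b) c"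
  unfolding shortest_mod_def
proof (intro allI impI)
  fix s t :: int
  assume *: "\<forall>s t :: int. \<bar>s\<bar> \<le> 1 \<longrightarrow> \<bar>t\<bar> \<le> 1 \<longrightarrow>
        a \<bullet> a \<le> (a + of_int s *\<^sub>R b + of_int t *\<^sub>R c) \<bullet> (a + of_int s *\<^sub>R b + of_int t *\<^sub>R c)"
    and "\<bar>s\<bar> \<le> 1" "\<bar>t\<bar> \<le> 1"
  then show "a \<bullet> a \<le> (a + of_int s *\<^sub>R - b + of_int t *\<^sub>R c) \<bullet> (a + of_int s *\<^sub>R - b + of_int t *\<^sub>R c)"
    using *[rule_format, of "- s" t] by simp
qed

lemma shortest_mod_uminus_left: "shortest_mod a b c \<Longrightarrow> shortest_mod (- a) b c"
  unfolding shortest_mod_def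
proof (intro allI impI)
  fix s t :: int
  assume *: "\<forall>s t :: int. \<bar>s\<bar> \<le> 1 \<longrightarrow> \<bar>t\<bar> \<le> 1 \<longrightarrow>
        a \<bullet> a \<le> (a + of_int s *\<^sub>R b + of_int t *\<^sub>R c) \<bullet> (a + of_int s *\<^sub>R b + of_int t *\<^sub>R c)"
    and "\<bar>s\<bar> \<le> 1" "\<bar>t\<bar> \<le> 1"
  then show "- a \<bullet> - a \<le> (- a + of_int s *\<^sub>R b + of_int t *\<^sub>R c) \<bullet> (- a + of_int s *\<^sub>R b + of_int t *\<^sub>R c)"
    using *[rule_format, of "- s" "- t"] by (simp add: inner_diff inner_add algebra_simps)
qed

text \<open>Expand the comparisons of \<open>a\<close> with \<open>a + b\<close> and
  \<open>a - b\<close>.\<close>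

lemma shortest_mod_inner:
  assumes "shortest_mod a b c" shows "2 * \<bar>a \<bullet> b\<bar> \<le> b \<bullet> b"
proof -
  have "a \<bullet> a \<le> (a + of_int s *\<^sub>R b) \<bullet> (a + of_int s *\<^sub>R b)" if "\<bar>s\<bar> \<le> 1" for s :: int
    using assms[unfolded shortest_mod_def, rule_format, of s 0] that by simp
  from this[of 1] this[of "-1"] show ?thesis
    by (simp add: inner_add inner_diff inner_commute)
qed

lemma reduced_rotate: "reduced_triple a b c \<Longrightarrow> reduced_triple b c a"
  by (simp add: reduced_triple_def)

lemma reduced_uminus: "reduced_triple a b c \<Longrightarrow> reduced_triple a b (- c)"
  unfolding reduced_triple_def
  by (meson shortest_mod_swap shortest_mod_uminus shortest_mod_uminus_left)

text \<open>Take a basis with least sum of squared lengths. A shear alters one vector only, so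
  minimality of the sum passes to that vector.\<close>

lemma exists_reduced_basis:
  assumes "lattice_packing L"
  obtains a b c where "basis_of L a b c" "reduced_triple a b c"
proof -
  define f :: "(real^3) \<times> (real^3) \<times> (real^3) \<Rightarrow> real" where "f = (\<lambda>(a, b, c). a \<bullet> a + b \<bullet> b + c \<bullet> c)"
  obtain a0 b0 c0 where 0: "basis_of L a0 b0 c0"
    using assms by (auto simp: lattice_packing_def is_lattice_def lattice_basis_iff)
  define r where "r = f (a0, b0, c0)"
  define S where "S = {x \<in> L. x \<bullet> x \<le> r}"
  \<comment> \<open>Distinct points of \<open>L\<close> are at distance at least 2, so the bounded
    part \<open>S\<close> is finite, and so is the set of candidate bases with sum at most
    \<open>r\<close>.\<close>
  have "uniform_discrete S"
  proof (rule uniformI2[of 2])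
    fix x y assume "x \<in> S" "y \<in> S" "x \<noteq> y"
    then have "4 \<le> (x - y) \<bullet> (x - y)"
      using assms basis_of_diff[OF 0, of x y] by (intro lattice_packing_min_norm) (auto simp: S_def)
    then have "2\<^sup>2 \<le> (dist x y)\<^sup>2"
      by (simp add: dist_norm power2_norm_eq_inner)
    then show "2 \<le> dist x y" using power2_le_imp_le zero_le_dist by blast
  qed simp
  moreover have "S \<subseteq> cball 0 (sqrt r)"
    by (auto simp: S_def norm_eq_sqrt_inner)
  ultimately have "finite S"
    using uniform_discrete_finite_iff bounded_cball bounded_subset by blast
  define T where "T = {(a, b, c). basis_of L a b c \<and> f (a, b, c) \<le> r}"
  have "T \<subseteq> S \<times> S \<times> S"
    using basis_of_members unfolding T_def S_def f_def
    by (auto intro: order_trans[rotated] simp: add_increasing add_increasing2)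
  then have "finite T"
    using \<open>finite S\<close> by (meson finite_SigmaI finite_subset)
  moreover have "(a0, b0, c0) \<in> T" using 0 by (simp add: T_def r_def)
  ultimately have "\<exists>m\<in>T. \<forall>x\<in>T. f m \<le> f x"
    using ex_min_if_finite[of "f ` T"] by (auto simp: not_less)
  then obtain a b c where T: "(a, b, c) \<in> T" and min: "\<And>y. y \<in> T \<Longrightarrow> f (a, b, c) \<le> f y"
    by (metis prod_cases3)
  have min: "f (a, b, c) \<le> f (x, y, z)" if "basis_of L x y z" for x y z
  proof (cases "f (x, y, z) \<le> r")
    case True then show ?thesis using min that by (simp add: T_def)
  next
    case False then show ?thesis using T by (simp add: T_def)
  qed
  have *: "shortest_mod a b c" if "basis_of L a b c" "\<And>x y z. basis_of L x y z \<Longrightarrow> f (a, b, c) \<le> f (x, y, z)"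
    for a b c
    unfolding shortest_mod_def
  proof (intro allI impI)
    fix s t :: int
    show "a \<bullet> a \<le> (a + of_int s *\<^sub>R b + of_int t *\<^sub>R c) \<bullet> (a + of_int s *\<^sub>R b + of_int t *\<^sub>R c)"
      using that(2)[OF basis_of_shear[OF that(1), of s t]] by (simp add: f_def)
  qed
  have f: "f (b, c, a) = f (a, b, c)" for a b c by (simp add: f_def)
  have abc: "basis_of L a b c" using T by (simp add: T_def)
  have "reduced_triple a b c"
    unfolding reduced_triple_def
    using *[OF abc] *[OF basis_of_rotate[OF abc]] *[OF basis_of_rotate[OF basis_of_rotate[OF abc]]] min
    by (simp add: f)
  then show ?thesis using that abc by blast
qed

text \<open>The projections of \<open>x1\<close>, \<open>x2\<close>, \<open>x3\<close> along \<open>d\<close> sum to zero and have pairwise nonpositive inner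
  products: they form an obtuse superbase of the projected lattice.\<close>

lemma projected_superbase:
  assumes bas: "basis_of L d a b" and red: "reduced_triple d a b"
  obtains x1 x2 x3 \<kappa> where
    "basis_of L d x1 x2" "x1 + x2 + x3 = of_int \<kappa> *\<^sub>R d"
    "2 * \<bar>x1 \<bullet> d\<bar> \<le> d \<bullet> d" "2 * \<bar>x2 \<bullet> d\<bar> \<le> d \<bullet> d" "2 * \<bar>x3 \<bullet> d\<bar> \<le> d \<bullet> d"
    "x1 \<bullet> x1 = a \<bullet> a" "x2 \<bullet> x2 = b \<bullet> b" "a \<bullet> a \<le> x3 \<bullet> x3"
    "2 * \<bar>x1 \<bullet> d\<bar> \<le> x1 \<bullet> x1" "2 * \<bar>x2 \<bullet> d\<bar> \<le> x2 \<bullet> x2"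
    "\<kappa> = 0 \<and> 2 * \<bar>x3 \<bullet> d\<bar> \<le> x3 \<bullet> x3 \<or> \<bar>\<kappa>\<bar> = 1 \<and> d \<bullet> d \<le> x3 \<bullet> x3"
    "(d \<bullet> d) * (x1 \<bullet> x2) \<le> (x1 \<bullet> d) * (x2 \<bullet> d)"
    "(d \<bullet> d) * (x1 \<bullet> x3) \<le> (x1 \<bullet> d) * (x3 \<bullet> d)"
    "(d \<bullet> d) * (x2 \<bullet> x3) \<le> (x2 \<bullet> d) * (x3 \<bullet> d)"
proof -
  define \<nu> where "\<nu> = d \<bullet> d"
  have "0 < \<nu>" using basis_of_nonzero[OF bas] by (simp add: \<nu>_def)
  \<comment> \<open>The sign of the second vector is chosen so that the projections of
    \<open>a\<close> and \<open>x2\<close> have nonpositive inner product.\<close>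
  obtain x2 where x2: "x2 = b \<or> x2 = - b" and "\<nu> * (a \<bullet> x2) \<le> (a \<bullet> d) * (x2 \<bullet> d)"
    by (cases "\<nu> * (a \<bullet> b) \<le> (a \<bullet> d) * (b \<bullet> d)") force+
  note ob = this(2)
  have red: "reduced_triple d a x2"
    using x2 red reduced_uminus by auto
  have bas: "basis_of L d a x2"
    using x2 bas basis_of_rotate basis_of_uminus by metis
  have sh: "shortest_mod d a x2" "shortest_mod a x2 d" "shortest_mod x2 d a"
    using red by (auto simp: reduced_triple_def)
  have i1: "2 * \<bar>a \<bullet> d\<bar> \<le> \<nu>" "2 * \<bar>a \<bullet> d\<bar> \<le> a \<bullet> a" "2 * \<bar>a \<bullet> x2\<bar> \<le> a \<bullet> a" "2 * \<bar>a \<bullet> x2\<bar> \<le> x2 \<bullet> x2"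
    "2 * \<bar>x2 \<bullet> d\<bar> \<le> \<nu>" "2 * \<bar>x2 \<bullet> d\<bar> \<le> x2 \<bullet> x2"
    using sh[THEN shortest_mod_inner] sh[THEN shortest_mod_swap, THEN shortest_mod_inner]
    by (auto simp: \<nu>_def inner_commute)
  \<comment> \<open>Adding \<kappa> times \<open>d\<close> to \<open>- a - x2\<close> brings the
    inner product with \<open>d\<close> into \<open>[- \<nu> / 2, \<nu> / 2]\<close>. By
    \<open>i1\<close> the uncorrected value has modulus at most \<nu>, so one step in either
    direction is enough.\<close>
  obtain \<kappa> :: int where \<kappa>: "\<bar>\<kappa>\<bar> \<le> 1" "2 * \<bar>\<kappa> * \<nu> - a \<bullet> d - x2 \<bullet> d\<bar> \<le> \<nu>"
  proof -
    consider "2 * \<bar>a \<bullet> d + x2 \<bullet> d\<bar> \<le> \<nu>" | "2 * (a \<bullet> d + x2 \<bullet> d) > \<nu>" | "2 * (a \<bullet> d + x2 \<bullet> d) < - \<nu>"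
      by linarith
    then show ?thesis
    proof cases
      case 1
      then have "2 * \<bar>- (a \<bullet> d) - x2 \<bullet> d\<bar> \<le> \<nu>" by (simp add: abs_if split: if_splits)
      then show ?thesis using that[of 0] by simp
    next
      case 2 then show ?thesis using that[of 1] i1 by simp
    next
      case 3 then show ?thesis using that[of "-1"] i1 by simp
    qed
  qed
  define x3 where "x3 = of_int \<kappa> *\<^sub>R d - a - x2"
  have x3d: "x3 \<bullet> d = \<kappa> * \<nu> - a \<bullet> d - x2 \<bullet> d"
    by (simp add: x3_def inner_diff_left \<nu>_def)
  have swap: "(- x) \<bullet> (- x) = x \<bullet> x" for x :: "real^3" by simp
  have n31: "a \<bullet> a \<le> x3 \<bullet> x3"
  proof -
    have "a \<bullet> a \<le> (a + of_int 1 *\<^sub>R x2 + of_int (- \<kappa>) *\<^sub>R d) \<bullet> (a + of_int 1 *\<^sub>R x2 + of_int (- \<kappa>) *\<^sub>R d)"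
      using sh(2)[unfolded shortest_mod_def, rule_format, of 1 "-\<kappa>"] \<kappa> by simp
    also have "a + of_int 1 *\<^sub>R x2 + of_int (- \<kappa>) *\<^sub>R d = - x3" by (simp add: x3_def)
    finally show ?thesis by simp
  qed
  \<comment> \<open>If \<kappa> is 0, then \<open>x3\<close> is \<open>- (a + x2)\<close>, and
    comparing \<open>d\<close> with \<open>d + a + x2\<close> and \<open>d - a - x2\<close> bounds
    its inner product with \<open>d\<close>. Otherwise \<open>x3\<close> is, up to sign, itself a
    shear of \<open>d\<close>.\<close>
  have cases: "\<kappa> = 0 \<and> 2 * \<bar>x3 \<bullet> d\<bar> \<le> x3 \<bullet> x3 \<or> \<bar>\<kappa>\<bar> = 1 \<and> d \<bullet> d \<le> x3 \<bullet> x3"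
  proof -
    have D: "d \<bullet> d \<le> (d + of_int s *\<^sub>R a + of_int s *\<^sub>R x2) \<bullet> (d + of_int s *\<^sub>R a + of_int s *\<^sub>R x2)"
      if "\<bar>s\<bar> \<le> 1" for s :: int
      using sh(1)[unfolded shortest_mod_def, rule_format, of s s] that by simp
    consider "\<kappa> = 0" | "\<kappa> = 1" | "\<kappa> = -1" using \<kappa>(1) by linarith
    then show ?thesis
    proof cases
      case 1
      then have x3: "x3 = - (a + x2)" by (simp add: x3_def)
      have "- (2 * (x3 \<bullet> d)) \<le> x3 \<bullet> x3" "2 * (x3 \<bullet> d) \<le> x3 \<bullet> x3"
        using D[of 1] D[of "-1"] unfolding x3
        by (simp_all add: algebra_simps inner_diff inner_add inner_commute)
      then show ?thesis using 1 by linarith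
    next
      case 2
      then show ?thesis using D[of "-1"] by (simp add: x3_def)
    next
      case 3
      then have "x3 = - (d + a + x2)" by (simp add: x3_def)
      then show ?thesis using D[of 1] 3 swap[of "d + a + x2"] by (simp only:) simp
    qed
  qed
  \<comment> \<open>This is the obtuseness of \<open>x\<close> against \<open>x3\<close> after
    expansion, where \<kappa> cancels. Both products on the left are at most
    \<open>\<nu> * (x \<bullet> x) / 4\<close>, and \<open>a \<bullet> x2\<close> is at least
    \<open>- (x \<bullet> x) / 2\<close>.\<close>
  have q: "(x \<bullet> d) * (x \<bullet> d) + (a \<bullet> d) * (x2 \<bullet> d) \<le> \<nu> * (x \<bullet> x) + \<nu> * (a \<bullet> x2)"
    if "x = a \<or> x = x2" for x
  proof -
    have "\<bar>x \<bullet> d\<bar> * \<bar>x \<bullet> d\<bar> \<le> (\<nu> / 2) * ((x \<bullet> x) / 2)"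
      using that i1 by (intro mult_mono) auto
    moreover have "\<bar>a \<bullet> d\<bar> * \<bar>x2 \<bullet> d\<bar> \<le> (\<nu> / 2) * ((x \<bullet> x) / 2)"
    proof (cases "x = a")
      case True
      have "\<bar>a \<bullet> d\<bar> * \<bar>x2 \<bullet> d\<bar> \<le> ((a \<bullet> a) / 2) * (\<nu> / 2)"
        using i1 by (intro mult_mono) auto
      then show ?thesis using True by (simp add: mult.commute)
    next
      case False
      then have "\<bar>a \<bullet> d\<bar> * \<bar>x2 \<bullet> d\<bar> \<le> (\<nu> / 2) * ((x2 \<bullet> x2) / 2)"
        using i1 by (intro mult_mono) auto
      then show ?thesis using False that by simp
    qed
    moreover have "\<nu> * (- (x \<bullet> x) / 2) \<le> \<nu> * (a \<bullet> x2)"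
      using i1 that \<open>0 < \<nu>\<close> by (intro mult_left_mono) auto
    moreover have "(a \<bullet> d) * (x2 \<bullet> d) \<le> \<bar>a \<bullet> d\<bar> * \<bar>x2 \<bullet> d\<bar>"
      by (metis abs_ge_self abs_mult)
    ultimately show ?thesis by (simp add: abs_mult_self_eq)
  qed
  have "(d \<bullet> d) * (a \<bullet> x3) \<le> (a \<bullet> d) * (x3 \<bullet> d)"
    using q[of a] unfolding x3d by (simp add: x3_def inner_diff_right inner_add_right \<nu>_def algebra_simps)
  moreover have "(d \<bullet> d) * (x2 \<bullet> x3) \<le> (x2 \<bullet> d) * (x3 \<bullet> d)"
    using q[of x2] unfolding x3d
    by (simp add: x3_def inner_diff_right inner_add_right \<nu>_def algebra_simps inner_commute[of x2 a])
  moreover have "x2 \<bullet> x2 = b \<bullet> b" using x2 by auto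
  moreover have "a + x2 + x3 = of_int \<kappa> *\<^sub>R d" by (simp add: x3_def)
  ultimately show ?thesis
    using that[of a x2 x3 \<kappa>] bas i1 \<kappa>(2) x3d n31 cases ob by (simp add: \<nu>_def)
qed

section \<open>Tunnels along reduced basis vectors\<close>

text \<open>Here \<open>a\<close>, \<open>b\<close> and \<open>a + b\<close> are the moduli of three
  coordinates with sum zero, and the term with the smallest one has weight 3 instead of 2. The loss
  \<open>Q * \<nu>\<close> is at most \<open>2 * (a + b) * \<nu>\<close>. If this is at most
  \<open>m\<close>, the bounds by \<open>m\<close> absorb it; otherwise the last assumption is a
  stronger bound for \<open>n3\<close>.\<close>

lemma zero_sum_inequality:
  fixes a b \<nu> m n1 n2 n3 :: real
  assumes "0 < m" "m \<le> \<nu>" "0 \<le> b" "b \<le> a" "a + b \<le> 1/2"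
    and "m \<le> n1" "m \<le> n2" "m \<le> n3" "2 * (a + b) * \<nu> \<le> n3"
  shows "6 * m \<le> 2 * ((n1 - a\<^sup>2 * \<nu>) + (n2 - b\<^sup>2 * \<nu>) + (n3 - (a + b)\<^sup>2 * \<nu>)) + (n2 - b\<^sup>2 * \<nu>)"
proof -
  define Q where "Q = 4 * a\<^sup>2 + 5 * b\<^sup>2 + 4 * a * b"
  have ab: "0 \<le> a" "b * b \<le> a * b" "0 \<le> a * b"
    using assms by (auto intro: mult_right_mono)
  have "(a + b) * (a + b) \<le> (a + b) * (1/2)"
    using assms ab by (intro mult_left_mono) auto
  then have Q: "Q \<le> 2 * (a + b)"
    using ab by (simp add: Q_def power2_eq_square algebra_simps)
  have goal: "?thesis \<longleftrightarrow> 6 * m + Q * \<nu> \<le> 2 * n1 + 3 * n2 + 2 * n3"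
    by (simp add: Q_def power2_eq_square algebra_simps)
  have "Q * \<nu> \<le> 2 * (a + b) * \<nu>"
    using Q assms by (intro mult_right_mono) auto
  show ?thesis
  proof (cases "2 * (a + b) * \<nu> \<le> m")
    case True
    then show ?thesis
      unfolding goal using \<open>Q * \<nu> \<le> _\<close> assms by linarith
  next
    case False
    then show ?thesis
      unfolding goal using \<open>Q * \<nu> \<le> _\<close> assms by linarith
  qed
qed

text \<open>In terms of the distances of \<open>a\<close> and \<open>b\<close> from
  \<open>1/2\<close>, whose sum is \<open>c\<close>, this is a quadratic inequality that follows
  from \<open>c\<close> being at most \<open>1/3\<close>. Equality holds at \<open>1/2\<close>,
  \<open>1/2\<close>, \<open>0\<close>.\<close>

lemma sum_squares_with_least_le:
  fixes a b c :: real
  assumes "0 \<le> c" "c \<le> a" "c \<le> b" "a \<le> 1/2" "b \<le> 1/2" "a + b + c = 1"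
  shows "2 * (a\<^sup>2 + b\<^sup>2 + c\<^sup>2) + c\<^sup>2 \<le> 1"
proof -
  define x y where "x = 1/2 - a" and "y = 1/2 - b"
  have c: "c = x + y" "0 \<le> x" "0 \<le> y" "3 * (x + y) \<le> 1"
    using assms by (auto simp: x_def y_def)
  have ab: "a = 1/2 - x" "b = 1/2 - y" by (auto simp: x_def y_def)
  define z where "z = x * y"
  have z: "0 \<le> z" using c by (simp add: z_def)
  have "(x + y) * (3 * (x + y)) \<le> (x + y) * 1"
    using c by (intro mult_left_mono) auto
  then have h: "3 * x\<^sup>2 + 6 * z + 3 * y\<^sup>2 \<le> x + y"
    by (simp add: z_def power2_eq_square algebra_simps)
  have "2 * (a\<^sup>2 + b\<^sup>2 + c\<^sup>2) + c\<^sup>2 = 1 - 2 * (x + y) + 5 * x\<^sup>2 + 6 * z + 5 * y\<^sup>2"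
    unfolding ab c(1) by (simp add: z_def power2_eq_square algebra_simps)
  moreover have "5 * x\<^sup>2 + 6 * z + 5 * y\<^sup>2 \<le> 2 * (x + y)"
    using h z c(2,3) by argo
  ultimately show ?thesis by linarith
qed

text \<open>The \<open>n\<close>s are squared lengths, \<nu> is \<open>d \<bullet> d\<close> and the
  \<open>t\<close>s are coordinates along \<open>d\<close> in units of \<open>d\<close>, so the
  \<open>W\<close>s are squared lengths of projections. The favoured \<open>W\<close> is the one
  with the least modulus of \<open>t\<close>, where projection loses least.\<close>

lemma tunnel_inequality:
  fixes t1 t2 t3 \<nu> m n1 n2 n3 :: real
  assumes m: "0 < m" "m \<le> \<nu>"
    and t: "\<bar>t1\<bar> \<le> 1/2" "\<bar>t2\<bar> \<le> 1/2" "\<bar>t3\<bar> \<le> 1/2"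
    and n: "m \<le> n1" "m \<le> n2" "m \<le> n3"
    and s: "(t1 + t2 + t3 = 0 \<and> 2 * \<bar>t1\<bar> * \<nu> \<le> n1 \<and> 2 * \<bar>t2\<bar> * \<nu> \<le> n2 \<and> 2 * \<bar>t3\<bar> * \<nu> \<le> n3)
      \<or> (\<bar>t1 + t2 + t3\<bar> = 1 \<and> \<nu> \<le> n3)"
    and W: "W1 = n1 - t1\<^sup>2 * \<nu>" "W2 = n2 - t2\<^sup>2 * \<nu>" "W3 = n3 - t3\<^sup>2 * \<nu>"
  shows "\<exists>W\<in>{W1, W2, W3}. 6 * m \<le> 2 * (W1 + W2 + W3) + W"
  using s
proof
  assume s: "t1 + t2 + t3 = 0 \<and> 2 * \<bar>t1\<bar> * \<nu> \<le> n1 \<and> 2 * \<bar>t2\<bar> * \<nu> \<le> n2 \<and> 2 * \<bar>t3\<bar> * \<nu> \<le> n3"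
  have *: "6 * m \<le> 2 * ((n1 - t1\<^sup>2 * \<nu>) + (n2 - t2\<^sup>2 * \<nu>) + (n3 - t3\<^sup>2 * \<nu>)) + (n2 - t2\<^sup>2 * \<nu>)"
    if "\<bar>t2\<bar> \<le> \<bar>t1\<bar>" "\<bar>t1\<bar> + \<bar>t2\<bar> = \<bar>t3\<bar>" "\<bar>t3\<bar> \<le> 1/2"
      "m \<le> n1" "m \<le> n2" "m \<le> n3" "2 * \<bar>t3\<bar> * \<nu> \<le> n3"
    for t1 t2 t3 n1 n2 n3 :: real
    using zero_sum_inequality[of m \<nu> "\<bar>t2\<bar>" "\<bar>t1\<bar>" n1 n2 n3] that m by simp
  have "\<bar>t1\<bar> + \<bar>t2\<bar> = \<bar>t3\<bar> \<or> \<bar>t1\<bar> + \<bar>t3\<bar> = \<bar>t2\<bar> \<or> \<bar>t2\<bar> + \<bar>t3\<bar> = \<bar>t1\<bar>"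
    using s by arith
  then consider
      "\<bar>t1\<bar> + \<bar>t2\<bar> = \<bar>t3\<bar>" "\<bar>t2\<bar> \<le> \<bar>t1\<bar>" | "\<bar>t1\<bar> + \<bar>t2\<bar> = \<bar>t3\<bar>" "\<bar>t1\<bar> \<le> \<bar>t2\<bar>"
    | "\<bar>t1\<bar> + \<bar>t3\<bar> = \<bar>t2\<bar>" "\<bar>t3\<bar> \<le> \<bar>t1\<bar>" | "\<bar>t1\<bar> + \<bar>t3\<bar> = \<bar>t2\<bar>" "\<bar>t1\<bar> \<le> \<bar>t3\<bar>"
    | "\<bar>t2\<bar> + \<bar>t3\<bar> = \<bar>t1\<bar>" "\<bar>t2\<bar> \<le> \<bar>t3\<bar>" | "\<bar>t2\<bar> + \<bar>t3\<bar> = \<bar>t1\<bar>" "\<bar>t3\<bar> \<le> \<bar>t2\<bar>"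
    by linarith
  then show ?thesis
  proof cases
    case 1 then show ?thesis using *[of t2 t1 t3 n1 n2 n3] s t n by (simp add: W)
  next
    case 2 then show ?thesis using *[of t1 t2 t3 n2 n1 n3] s t n by (simp add: W)
  next
    case 3 then show ?thesis using *[of t3 t1 t2 n1 n3 n2] s t n by (simp add: W)
  next
    case 4 then show ?thesis using *[of t1 t3 t2 n3 n1 n2] s t n by (simp add: W)
  next
    case 5 then show ?thesis using *[of t2 t3 t1 n3 n2 n1] s t n by (simp add: W)
  next
    case 6 then show ?thesis using *[of t3 t2 t1 n2 n3 n1] s t n by (simp add: W)
  qed
next
  assume s: "\<bar>t1 + t2 + t3\<bar> = 1 \<and> \<nu> \<le> n3"
  \<comment> \<open>Each coordinate has modulus at most \<open>1/2\<close>, so a sum of modulus 1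
    forces a common sign.\<close>
  have a: "\<bar>t1\<bar> + \<bar>t2\<bar> + \<bar>t3\<bar> = 1"
    using s t by arith
  have *: "(2 * (t1\<^sup>2 + t2\<^sup>2 + t3\<^sup>2) + t3\<^sup>2) * \<nu> \<le> 1 * \<nu>"
    if "\<bar>t1\<bar> + \<bar>t2\<bar> + \<bar>t3\<bar> = 1" "\<bar>t3\<bar> \<le> \<bar>t1\<bar>" "\<bar>t3\<bar> \<le> \<bar>t2\<bar>" "\<bar>t1\<bar> \<le> 1/2" "\<bar>t2\<bar> \<le> 1/2"
    for t1 t2 t3 :: real
    using sum_squares_with_least_le[of "\<bar>t3\<bar>" "\<bar>t1\<bar>" "\<bar>t2\<bar>"] that m by (intro mult_right_mono) auto
  consider "\<bar>t3\<bar> \<le> \<bar>t1\<bar>" "\<bar>t3\<bar> \<le> \<bar>t2\<bar>" | "\<bar>t1\<bar> \<le> \<bar>t2\<bar>" "\<bar>t1\<bar> \<le> \<bar>t3\<bar>"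
    | "\<bar>t2\<bar> \<le> \<bar>t1\<bar>" "\<bar>t2\<bar> \<le> \<bar>t3\<bar>"
    by linarith
  then show ?thesis
  proof cases
    case 1
    from *[OF a this t(1,2)] have "6 * m \<le> 2 * (W1 + W2 + W3) + W3"
      unfolding W using n s m by (simp add: algebra_simps)
    then show ?thesis by simp
  next
    case 2
    from *[of t2 t3 t1] this a t have "6 * m \<le> 2 * (W1 + W2 + W3) + W1"
      unfolding W using n s m by (simp add: algebra_simps)
    then show ?thesis by simp
  next
    case 3
    from *[of t1 t3 t2] this a t have "6 * m \<le> 2 * (W1 + W2 + W3) + W2"
      unfolding W using n s m by (simp add: algebra_simps)
    then show ?thesis by simp
  qed
qed

section \<open>Orthogonal projection along a vector\<close>

definition perp :: "real^3 \<Rightarrow> real^3 \<Rightarrow> real^3" where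
  "perp d x = x - ((x \<bullet> d) / (d \<bullet> d)) *\<^sub>R d"

lemma perp_add: "perp d (x + y) = perp d x + perp d y"
  by (simp add: perp_def inner_add_left add_divide_distrib algebra_simps)

lemma perp_scaleR: "perp d (c *\<^sub>R x) = c *\<^sub>R perp d x"
  by (simp add: perp_def algebra_simps)

lemma perp_diff: "perp d (x - y) = perp d x - perp d y"
  by (simp add: perp_def inner_diff_left diff_divide_distrib algebra_simps)

lemma perp_self: "d \<noteq> 0 \<Longrightarrow> perp d d = 0"
  by (simp add: perp_def)

lemma perp_orthogonal: "x \<bullet> d = 0 \<Longrightarrow> perp d x = x"
  by (simp add: perp_def)

lemma inner_perp_axis: "d \<noteq> 0 \<Longrightarrow> perp d x \<bullet> d = 0"
  by (simp add: perp_def inner_diff_left)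

lemma inner_perp: "d \<noteq> 0 \<Longrightarrow> perp d x \<bullet> perp d y = x \<bullet> y - (x \<bullet> d) * (y \<bullet> d) / (d \<bullet> d)"
  by (simp add: perp_def inner_diff_left inner_diff_right inner_commute)

lemma perp_norm_le: "perp d x \<bullet> perp d x \<le> x \<bullet> x"
  by (cases "d = 0") (simp_all add: inner_perp, simp add: perp_def)

lemma exists_inner_eq:
  assumes "det3 a b c \<noteq> 0"
  obtains p where "p \<bullet> a = \<alpha>" "p \<bullet> b = \<beta>" "p \<bullet> c = \<gamma>"
proof -
  define M :: "real^3^3" where "M = vector [a, b, c]"
  have "invertible M" using assms by (simp add: M_def det3_def invertible_det_nz)
  then obtain N where "M ** N = mat 1" by (auto simp: invertible_def)
  then have "M *v (N *v vector [\<alpha>, \<beta>, \<gamma>]) = vector [\<alpha>, \<beta>, \<gamma>]"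
    by (simp add: matrix_vector_mul_assoc)
  then obtain p where p: "M *v p = vector [\<alpha>, \<beta>, \<gamma>]" by blast
  have "(M *v p) $ 1 = p \<bullet> a" "(M *v p) $ 2 = p \<bullet> b" "(M *v p) $ 3 = p \<bullet> c"
    by (simp_all add: matrix_vector_mult_def M_def inner_vec_def mult.commute)
  then show ?thesis using that p by simp
qed

lemma orthogonal_to_basis:
  assumes "det3 a b c \<noteq> 0" "p \<bullet> a = 0" "p \<bullet> b = 0" "p \<bullet> c = 0"
  shows "p = 0"
proof -
  define M :: "real^3^3" where "M = vector [a, b, c]"
  have "invertible M" using assms by (simp add: M_def det3_def invertible_det_nz)
  then obtain N where "N ** M = mat 1" by (auto simp: invertible_def)
  moreover have "M *v p = 0"
    using assms
    by (simp add: vec_eq_iff forall_3 matrix_vector_mult_def M_def inner_vec_def mult.commute)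
  ultimately have "p = N *v 0"
    by (metis matrix_vector_mul_assoc matrix_vector_mul_lid)
  then show ?thesis by simp
qed

text \<open>No integer lies strictly between 0 and 1. This is why no lattice point projects into the
  open circumdisc in \<open>circumcentre_far\<close>.\<close>

lemma int_mult_pred_nonneg: "0 \<le> of_int k * (of_int k - 1 :: real)"
proof -
  have "0 \<le> k * (k - 1)" by (cases "1 \<le> k") (auto simp: mult_nonneg_nonpos2 mult_nonpos_nonpos)
  then have "0 \<le> real_of_int (k * (k - 1))" by (simp only: of_int_0_le_iff)
  then show ?thesis by simp
qed

text \<open>The witness \<open>p\<close> is the circumcentre of the triangle \<open>0\<close>, \<open>w1\<close>, \<open>- w3\<close> spanned by the
  projected superbase; its circumradius is bounded below by Leibniz' formula with
  the weights \<open>1/4\<close>, \<open>3/8\<close>, \<open>3/8\<close>, which is sharp for the face-centred cubic lattice.\<close>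

lemma circumcentre_far:
  assumes bas: "basis_of L d x1 x2" and sum: "x1 + x2 + x3 = of_int \<kappa> *\<^sub>R d"
    and ob: "perp d x1 \<bullet> perp d x2 \<le> 0" "perp d x1 \<bullet> perp d x3 \<le> 0" "perp d x2 \<bullet> perp d x3 \<le> 0"
    and W: "W1 = perp d x1 \<bullet> perp d x1" "W2 = perp d x2 \<bullet> perp d x2" "W3 = perp d x3 \<bullet> perp d x3"
    and C: "\<exists>W\<in>{W1, W2, W3}. 64 * C \<le> 3 * (2 * (W1 + W2 + W3) + W)"
  shows "\<exists>p. \<forall>x\<in>L. \<forall>t. C \<le> (x - p - t *\<^sub>R d) \<bullet> (x - p - t *\<^sub>R d)"
proof -
  have d: "d \<noteq> 0" using basis_of_nonzero bas by blast
  define w1 w2 w3 where w: "w1 = perp d x1" "w2 = perp d x2" "w3 = perp d x3"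
  have "perp d (x1 + x2 + x3) = 0"
    unfolding sum by (simp add: perp_scaleR perp_self d)
  then have w2: "w2 = - w1 - w3"
    by (simp add: w perp_add algebra_simps add_eq_0_iff)
  \<comment> \<open>The conditions place \<open>p\<close> orthogonal to \<open>d\<close> and
    equidistant from \<open>0\<close>, \<open>w1\<close> and \<open>- w3\<close>; the value for
    \<open>x2\<close> comes from \<open>w2 = - w1 - w3\<close>.\<close>
  obtain p where p: "p \<bullet> d = 0" "p \<bullet> x1 = W1 / 2" "p \<bullet> x2 = (W3 - W1) / 2"
    using exists_inner_eq bas unfolding basis_of_def by blast
  have pw: "p \<bullet> perp d x = p \<bullet> x" for x
    by (simp add: perp_def inner_diff_right p)
  have "p \<bullet> w2 = - (p \<bullet> w1) - p \<bullet> w3" by (simp add: w2 inner_diff_right)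
  then have pw13: "p \<bullet> w1 = W1 / 2" "p \<bullet> w3 = - W3 / 2"
    using pw p by (simp_all add: w)
  define q where "q = w1 \<bullet> w3"
  have W': "W1 = w1 \<bullet> w1" "W3 = w3 \<bullet> w3" "W2 = W1 + W3 + 2 * q"
    using W by (simp_all add: w[symmetric])
      (simp add: w2 q_def inner_diff_left inner_diff_right inner_commute)
  have ob': "0 \<le> - q" "0 \<le> W1 + q" "0 \<le> W3 + q"
    using ob unfolding w[symmetric]
    by (simp_all add: w2 W' q_def inner_diff_left inner_diff_right inner_commute)
  \<comment> \<open>The squared distance of \<open>p\<close> from a point of the plane, in terms of
    the Selling parameters \<open>W1 + q\<close>, \<open>W3 + q\<close>, \<open>- q\<close>, the
    negated inner products of the superbase. Their terms vanish at the three vertices, so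
    \<open>p \<bullet> p\<close> is the squared circumradius.\<close>
  have expand: "(\<alpha> *\<^sub>R w1 - \<mu> *\<^sub>R w3 - p) \<bullet> (\<alpha> *\<^sub>R w1 - \<mu> *\<^sub>R w3 - p)
      = \<alpha> * (\<alpha> - 1) * (W1 + q) + \<mu> * (\<mu> - 1) * (W3 + q) + (\<alpha> + \<mu>) * (\<alpha> + \<mu> - 1) * (- q) + p \<bullet> p"
    for \<alpha> \<mu> :: real
  proof -
    have "(\<alpha> *\<^sub>R w1 - \<mu> *\<^sub>R w3 - p) \<bullet> (\<alpha> *\<^sub>R w1 - \<mu> *\<^sub>R w3 - p)
      = \<alpha> * \<alpha> * (w1 \<bullet> w1) + \<mu> * \<mu> * (w3 \<bullet> w3) - 2 * \<alpha> * \<mu> * (w1 \<bullet> w3)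
        - 2 * \<alpha> * (p \<bullet> w1) + 2 * \<mu> * (p \<bullet> w3) + p \<bullet> p"
      by (simp add: inner_diff_left inner_diff_right inner_commute[of w3 w1]
          inner_commute[of w1 p] inner_commute[of w3 p] algebra_simps)
    then show ?thesis
      unfolding pw13 W'(1,2)[symmetric] q_def[symmetric] by (simp add: algebra_simps)
  qed
  have leibniz: "64 * C \<le> 64 * (p \<bullet> p)"
  proof -
    \<comment> \<open>A squared distance is nonnegative; below, it is taken from \<open>p\<close> to
      the point with the given barycentric weights. The weight \<open>1/4\<close> sits at the vertex
      opposite to the edge of squared length \<open>W\<close>.\<close>
    have *: "0 \<le> \<alpha> * (\<alpha> - 1) * (W1 + q) + \<mu> * (\<mu> - 1) * (W3 + q)
        + (\<alpha> + \<mu>) * (\<alpha> + \<mu> - 1) * (- q) + p \<bullet> p" for \<alpha> \<mu> :: real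
      unfolding expand[symmetric] by simp
    from C show ?thesis
    proof (elim bexE insertE emptyE)
      fix W assume "64 * C \<le> 3 * (2 * (W1 + W2 + W3) + W)" "W = W1"
      then show ?thesis using *[of "3/8" "1/4"] W'(3) by (simp add: field_simps)
    next
      fix W assume "64 * C \<le> 3 * (2 * (W1 + W2 + W3) + W)" "W = W2"
      then show ?thesis using *[of "3/8" "3/8"] W'(3) by (simp add: field_simps)
    next
      fix W assume "64 * C \<le> 3 * (2 * (W1 + W2 + W3) + W)" "W = W3"
      then show ?thesis using *[of "1/4" "3/8"] W'(3) by (simp add: field_simps)
    qed
  qed
  show ?thesis
  proof (intro exI ballI allI)
    fix x and t :: real assume "x \<in> L"
    then obtain i j k :: int where "x = of_int i *\<^sub>R d + of_int j *\<^sub>R x1 + of_int k *\<^sub>R x2"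
      using bas by (auto simp: basis_of_def int_span_def)
    then have "perp d (x - p - t *\<^sub>R d) = of_int j *\<^sub>R w1 + of_int k *\<^sub>R w2 - p"
      by (simp add: perp_add perp_diff perp_scaleR perp_self d perp_orthogonal p w)
    also have "\<dots> = of_int (j - k) *\<^sub>R w1 - of_int k *\<^sub>R w3 - p"
      by (simp add: w2 algebra_simps)
    finally have eq: "perp d (x - p - t *\<^sub>R d) = \<dots>" .
    \<comment> \<open>The circumcircle is empty: products of consecutive integers are nonnegative,
      and so are the Selling parameters by \<open>ob'\<close>.\<close>
    have "0 \<le> of_int (j - k) * (of_int (j - k) - 1) * (W1 + q) + of_int k * (of_int k - 1) * (W3 + q)
        + of_int ((j - k) + k) * (of_int ((j - k) + k) - 1) * (- q)"
      using mult_nonneg_nonneg[OF int_mult_pred_nonneg[of "j - k"] ob'(2)]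
        mult_nonneg_nonneg[OF int_mult_pred_nonneg[of k] ob'(3)]
        mult_nonneg_nonneg[OF int_mult_pred_nonneg[of "(j - k) + k"] ob'(1)] by linarith
    then have "p \<bullet> p \<le> perp d (x - p - t *\<^sub>R d) \<bullet> perp d (x - p - t *\<^sub>R d)"
      unfolding eq expand by simp
    then show "C \<le> (x - p - t *\<^sub>R d) \<bullet> (x - p - t *\<^sub>R d)"
      using leibniz perp_norm_le[of d "x - p - t *\<^sub>R d"] by linarith
  qed
qed

lemma line_far_from_lattice:
  assumes bas: "basis_of L d a b" and red: "reduced_triple d a b"
    and min: "\<And>x. x \<in> L \<Longrightarrow> x \<noteq> 0 \<Longrightarrow> 4 \<le> x \<bullet> x"
  shows "\<exists>p. \<forall>x\<in>L. \<forall>t. 9 / 8 \<le> (x - p - t *\<^sub>R d) \<bullet> (x - p - t *\<^sub>R d)"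
proof -
  obtain x1 x2 x3 \<kappa> where x: "basis_of L d x1 x2" "x1 + x2 + x3 = of_int \<kappa> *\<^sub>R d"
    "2 * \<bar>x1 \<bullet> d\<bar> \<le> d \<bullet> d" "2 * \<bar>x2 \<bullet> d\<bar> \<le> d \<bullet> d" "2 * \<bar>x3 \<bullet> d\<bar> \<le> d \<bullet> d"
    "x1 \<bullet> x1 = a \<bullet> a" "x2 \<bullet> x2 = b \<bullet> b" "a \<bullet> a \<le> x3 \<bullet> x3"
    "2 * \<bar>x1 \<bullet> d\<bar> \<le> x1 \<bullet> x1" "2 * \<bar>x2 \<bullet> d\<bar> \<le> x2 \<bullet> x2"
    "\<kappa> = 0 \<and> 2 * \<bar>x3 \<bullet> d\<bar> \<le> x3 \<bullet> x3 \<or> \<bar>\<kappa>\<bar> = 1 \<and> d \<bullet> d \<le> x3 \<bullet> x3"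
    and ob: "(d \<bullet> d) * (x1 \<bullet> x2) \<le> (x1 \<bullet> d) * (x2 \<bullet> d)"
    "(d \<bullet> d) * (x1 \<bullet> x3) \<le> (x1 \<bullet> d) * (x3 \<bullet> d)"
    "(d \<bullet> d) * (x2 \<bullet> x3) \<le> (x2 \<bullet> d) * (x3 \<bullet> d)"
    by (rule projected_superbase[OF bas red])
  have min: "4 \<le> d \<bullet> d" "4 \<le> a \<bullet> a" "4 \<le> b \<bullet> b"
    using min basis_of_members[OF bas] basis_of_nonzero[OF bas] by auto
  then have d: "d \<noteq> 0" "0 < d \<bullet> d" by auto
  have ob': "perp d y \<bullet> perp d z \<le> 0" if "(d \<bullet> d) * (y \<bullet> z) \<le> (y \<bullet> d) * (z \<bullet> d)" for y z
    using that d by (simp add: inner_perp field_simps)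
  define t where "t x = (x \<bullet> d) / (d \<bullet> d)" for x
  have t: "x \<bullet> d = t x * (d \<bullet> d)" "perp d x \<bullet> perp d x = x \<bullet> x - (t x)\<^sup>2 * (d \<bullet> d)" for x
    using d by (simp_all add: t_def inner_perp power2_eq_square)
  have ab: "\<bar>x \<bullet> d\<bar> = \<bar>t x\<bar> * (d \<bullet> d)" for x
    using d by (simp add: t_def)
  have ab2: "\<bar>t x\<bar> \<le> 1 / 2" if "2 * \<bar>x \<bullet> d\<bar> \<le> d \<bullet> d" for x
    using that d unfolding t_def by (simp add: field_simps)
  have "(t x1 + t x2 + t x3) * (d \<bullet> d) = (x1 + x2 + x3) \<bullet> d"
    using d by (simp add: t_def inner_add_left add_divide_distrib[symmetric])
  then have ts: "t x1 + t x2 + t x3 = of_int \<kappa>"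
    using d unfolding x(2) by simp
  show ?thesis
  proof (rule circumcentre_far[OF x(1,2) ob[THEN ob'] refl refl refl])
    \<comment> \<open>With \<open>m = 4\<close>, three times the bound \<open>6 * 4\<close> is
      \<open>64 * (9 / 8)\<close>, the constant of \<open>circumcentre_far\<close>.\<close>
    have "\<exists>W\<in>{perp d x1 \<bullet> perp d x1, perp d x2 \<bullet> perp d x2, perp d x3 \<bullet> perp d x3}.
        6 * 4 \<le> 2 * (perp d x1 \<bullet> perp d x1 + perp d x2 \<bullet> perp d x2 + perp d x3 \<bullet> perp d x3) + W"
    proof (rule tunnel_inequality[OF _ min(1) ab2[OF x(3)] ab2[OF x(4)] ab2[OF x(5)] _ _ _ _ t(2) t(2) t(2)])
      show "t x1 + t x2 + t x3 = 0 \<and> 2 * \<bar>t x1\<bar> * (d \<bullet> d) \<le> x1 \<bullet> x1 \<and>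
          2 * \<bar>t x2\<bar> * (d \<bullet> d) \<le> x2 \<bullet> x2 \<and> 2 * \<bar>t x3\<bar> * (d \<bullet> d) \<le> x3 \<bullet> x3
        \<or> \<bar>t x1 + t x2 + t x3\<bar> = 1 \<and> d \<bullet> d \<le> x3 \<bullet> x3"
        using x(9-11) unfolding ts ab by (auto simp: mult.assoc)
    qed (use x min in auto)
    then show "\<exists>W\<in>{perp d x1 \<bullet> perp d x1, perp d x2 \<bullet> perp d x2, perp d x3 \<bullet> perp d x3}.
        64 * (9 / 8) \<le> 3 * (2 * (perp d x1 \<bullet> perp d x1 + perp d x2 \<bullet> perp d x2 + perp d x3 \<bullet> perp d x3) + W)"
      by auto
  qed
qed

section \<open>Gauss' bound and its equality case\<close>

lemma square_of_abs_half:
  fixes s :: real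
  assumes "\<bar>s\<bar> = 1/2" shows "s\<^sup>2 = 1/4"
proof -
  have "s\<^sup>2 = \<bar>s\<bar>\<^sup>2" by simp
  also have "\<dots> = 1/4" by (simp only: assms) (simp add: power2_eq_square)
  finally show ?thesis .
qed

text \<open>The \<open>W\<close>s are the squared edges of the projected triangle. By Heron's
  formula the bracket in \<open>small\<close> is 16 times its squared area, and it is at least
  \<open>2 * \<nu>\<^sup>2\<close>. Hence \<open>4 \<le> \<nu>\<close> leaves only the case of
  equality, where every deficit vanishes.\<close>

lemma gauss_inequality:
  fixes t1 t2 t3 \<nu> W1 W2 W3 :: real
  assumes \<nu>: "4 \<le> \<nu>"
    and t: "\<bar>t1\<bar> \<le> 1/2" "\<bar>t2\<bar> \<le> 1/2" "\<bar>t3\<bar> \<le> 1/2"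
    and s: "t1 + t2 + t3 = 0 \<or> \<bar>t1 + t2 + t3\<bar> = 1"
    and W: "\<nu> * (1 - t1\<^sup>2) \<le> W1" "\<nu> * (1 - t2\<^sup>2) \<le> W2" "\<nu> * (1 - t3\<^sup>2) \<le> W3"
    and ac: "W1 \<le> W2 + W3" "W2 \<le> W1 + W3" "W3 \<le> W1 + W2"
    and small: "\<nu> * (4 * W1 * W2 - (W3 - W1 - W2)\<^sup>2) \<le> 128"
  shows "\<nu> = 4" "W1 = 4 * (1 - t1\<^sup>2)" "W2 = 4 * (1 - t2\<^sup>2)" "W3 = 4 * (1 - t3\<^sup>2)"
    "t1 = 0 \<and> \<bar>t2\<bar> = 1/2 \<and> \<bar>t3\<bar> = 1/2 \<or> \<bar>t1\<bar> = 1/2 \<and> t2 = 0 \<and> \<bar>t3\<bar> = 1/2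
      \<or> \<bar>t1\<bar> = 1/2 \<and> \<bar>t2\<bar> = 1/2 \<and> t3 = 0"
proof -
  define c1 c2 c3 where c: "c1 = \<nu> * (1 - t1\<^sup>2)" "c2 = \<nu> * (1 - t2\<^sup>2)" "c3 = \<nu> * (1 - t3\<^sup>2)"
  define F where "F x y z = 4 * x * y - (z - x - y)\<^sup>2" for x y z :: real
  \<comment> \<open>The deficit \<open>\<bar>x\<bar> * (1/2 - \<bar>x\<bar>)\<close> is nonnegative
    on the allowed range and zero only at 0 and at modulus \<open>1/2\<close>.\<close>
  define h where "h x = \<bar>x\<bar> / 2 - x\<^sup>2" for x :: real
  have h: "0 \<le> h x" if "\<bar>x\<bar> \<le> 1/2" for x
  proof -
    have "\<bar>x\<bar> * \<bar>x\<bar> \<le> \<bar>x\<bar> * (1/2)" using that by (intro mult_left_mono) auto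
    then show ?thesis by (simp add: h_def power2_eq_square)
  qed
  have abs1: "\<bar>t1\<bar> + \<bar>t2\<bar> + \<bar>t3\<bar> \<le> 1"
    using s t by arith
  have T: "t1\<^sup>2 + t2\<^sup>2 + t3\<^sup>2 \<le> 1/2 - h t1 - h t2 - h t3"
    using abs1 by (simp add: h_def)
  have sq: "0 \<le> x\<^sup>2" "x\<^sup>2 \<le> 1/4" if "\<bar>x\<bar> \<le> 1/2" for x :: real
    using power_mono[of "\<bar>x\<bar>" "1/2" 2] that by (simp_all add: power2_eq_square)
  \<comment> \<open>Heron's expression for edges \<open>t1\<close>, \<open>t2\<close>,
    \<open>t3\<close>. It factors; the product is zero if the coordinates sum to zero, and otherwise
    no factor has the sign opposite to the sum.\<close>
  define P where "P = F (t1\<^sup>2) (t2\<^sup>2) (t3\<^sup>2)"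
  have P: "0 \<le> P"
  proof -
    have P1: "P = (t1 + t2 + t3) * (- t1 + t2 + t3) * (t1 - t2 + t3) * (t1 + t2 - t3)"
      unfolding P_def F_def by algebra
    from s show ?thesis
    proof
      assume "t1 + t2 + t3 = 0" then show ?thesis by (simp add: P1)
    next
      assume "\<bar>t1 + t2 + t3\<bar> = 1"
      then consider "t1 + t2 + t3 = 1" | "t1 + t2 + t3 = - 1" by linarith
      then show ?thesis
      proof cases
        case 1
        then have "- t1 + t2 + t3 \<ge> 0" "t1 - t2 + t3 \<ge> 0" "t1 + t2 - t3 \<ge> 0"
          using t by linarith+
        then show ?thesis unfolding P1 1 by simp
      next
        case 2
        then have "- (- t1 + t2 + t3) \<ge> 0" "- (t1 - t2 + t3) \<ge> 0" "- (t1 + t2 - t3) \<ge> 0"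
          using t by linarith+
        then have "0 \<le> - (- t1 + t2 + t3) * - (t1 - t2 + t3) * - (t1 + t2 - t3)"
          by (intro mult_nonneg_nonneg)
        also have "\<dots> = - 1 * (- t1 + t2 + t3) * (t1 - t2 + t3) * (t1 + t2 - t3)"
          by algebra
        finally show ?thesis unfolding P1 2 .
      qed
    qed
  qed
  \<comment> \<open>Expansion of the quadratic form \<open>F\<close> around
    \<open>(1, 1, 1)\<close>, where its value is 3.\<close>
  have Fc0: "F c1 c2 c3 = \<nu>\<^sup>2 * (3 - 2 * (t1\<^sup>2 + t2\<^sup>2 + t3\<^sup>2) + P)"
    unfolding P_def F_def c by algebra
  moreover have "\<nu>\<^sup>2 * (2 + 2 * (h t1 + h t2 + h t3)) \<le> \<nu>\<^sup>2 * (3 - 2 * (t1\<^sup>2 + t2\<^sup>2 + t3\<^sup>2) + P)"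
    using P T by (intro mult_left_mono) auto
  ultimately have Fc: "\<nu>\<^sup>2 * (2 + 2 * (h t1 + h t2 + h t3)) \<le> F c1 c2 c3" by simp
  \<comment> \<open>The triangle with squared edges \<open>c1\<close>, \<open>c2\<close>,
    \<open>c3\<close> is acute with a margin, which gives a rate at which \<open>F\<close> grows
    from the \<open>c\<close>s to the \<open>W\<close>s.\<close>
  have acc: "\<nu> / 2 \<le> c2 + c3 - c1" "\<nu> / 2 \<le> c1 + c3 - c2" "\<nu> / 2 \<le> c1 + c2 - c3"
  proof -
    have *: "\<nu> * (1/2) \<le> \<nu> * (1 - x - y + z)" if "x \<le> 1/4" "y \<le> 1/4" "0 \<le> z" for x y z
      using that \<nu> by (intro mult_left_mono) auto
    show "\<nu> / 2 \<le> c2 + c3 - c1" "\<nu> / 2 \<le> c1 + c3 - c2" "\<nu> / 2 \<le> c1 + c2 - c3"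
      using *[of "t2\<^sup>2" "t3\<^sup>2" "t1\<^sup>2"] *[of "t1\<^sup>2" "t3\<^sup>2" "t2\<^sup>2"] *[of "t1\<^sup>2" "t2\<^sup>2" "t3\<^sup>2"]
        sq t unfolding c by (simp_all add: algebra_simps)
  qed
  define e1 e2 e3 where e: "e1 = W1 - c1" "e2 = W2 - c2" "e3 = W3 - c3"
  have e0: "0 \<le> e1" "0 \<le> e2" "0 \<le> e3" using W by (auto simp: e c)
  \<comment> \<open>\<open>F\<close> is a quadratic form, so \<open>F W - F c\<close> is its polar form at \<open>W - c\<close> and \<open>W + c\<close>\<close>
  have "F W1 W2 W3 = F c1 c2 c3 + e1 * ((c2 + c3 - c1) + (W2 + W3 - W1))
      + e2 * ((c1 + c3 - c2) + (W1 + W3 - W2)) + e3 * ((c1 + c2 - c3) + (W1 + W2 - W3))"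
    unfolding F_def e by algebra
  moreover have "e1 * (\<nu> / 2) \<le> e1 * ((c2 + c3 - c1) + (W2 + W3 - W1))"
      "e2 * (\<nu> / 2) \<le> e2 * ((c1 + c3 - c2) + (W1 + W3 - W2))"
      "e3 * (\<nu> / 2) \<le> e3 * ((c1 + c2 - c3) + (W1 + W2 - W3))"
    using acc ac e0 by (intro mult_left_mono; linarith)+
  ultimately have FW: "\<nu>\<^sup>2 * (2 + 2 * (h t1 + h t2 + h t3)) + (e1 + e2 + e3) * (\<nu> / 2) \<le> F W1 W2 W3"
    using Fc by (simp only: distrib_right)
  define H where "H = h t1 + h t2 + h t3"
  have H: "0 \<le> H" "0 \<le> h t1" "0 \<le> h t2" "0 \<le> h t3" using h t by (auto simp: H_def)
  have "\<nu> * (\<nu>\<^sup>2 * (2 + 2 * H) + (e1 + e2 + e3) * (\<nu> / 2)) \<le> \<nu> * F W1 W2 W3"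
    using FW \<nu> unfolding H_def by (intro mult_left_mono) auto
  \<comment> \<open>Since \<open>4 \<le> \<nu>\<close>, the leading term alone reaches 128. So the
    nonnegative rest is zero and \<nu> is 4.\<close>
  then have up: "2 * \<nu>^3 + (2 * H * \<nu>^3 + (e1 + e2 + e3) * \<nu>\<^sup>2 / 2) \<le> 128"
    using small by (simp add: F_def algebra_simps power2_eq_square power3_eq_cube)
  have r: "0 \<le> 2 * H * \<nu>^3" "0 \<le> (e1 + e2 + e3) * \<nu>\<^sup>2 / 2"
    using H e0 \<nu> by auto
  have "4^3 \<le> \<nu>^3" using \<nu> by (intro power_mono) auto
  then have "64 \<le> \<nu>^3" by simp
  then have z: "2 * H * \<nu>^3 = 0" "(e1 + e2 + e3) * \<nu>\<^sup>2 / 2 = 0" "\<nu>^3 = 64"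
    using up r by linarith+
  show \<nu>4: "\<nu> = 4" using z(3) \<nu> power_inject_base[of \<nu> 2 4] by (simp add: eval_nat_numeral)
  have "H = 0" "e1 + e2 + e3 = 0" using z(1,2) \<nu> by auto
  then have z: "h t1 = 0" "h t2 = 0" "h t3 = 0" "e1 = 0" "e2 = 0" "e3 = 0"
    using H e0 unfolding H_def by linarith+
  then show "W1 = 4 * (1 - t1\<^sup>2)" "W2 = 4 * (1 - t2\<^sup>2)" "W3 = 4 * (1 - t3\<^sup>2)"
    using \<nu>4 by (simp_all add: e c)
  have hz: "x = 0 \<or> \<bar>x\<bar> = 1/2" if "h x = 0" for x
  proof -
    have "\<bar>x\<bar> * (1/2 - \<bar>x\<bar>) = h x" by (simp add: h_def power2_eq_square algebra_simps)
    then have "\<bar>x\<bar> = 0 \<or> 1/2 - \<bar>x\<bar> = 0" using that by (simp only: mult_eq_0_iff)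
    then show ?thesis by auto
  qed
  \<comment> \<open>Each square is 0 or \<open>1/4\<close>, so the value \<open>1/2\<close> means
    that exactly one coordinate is zero.\<close>
  have "t1\<^sup>2 + t2\<^sup>2 + t3\<^sup>2 = 1/2"
  proof -
    have "F c1 c2 c3 \<le> 32" using small z \<nu>4 by (simp add: F_def e)
    then have "16 * (3 - 2 * (t1\<^sup>2 + t2\<^sup>2 + t3\<^sup>2) + P) \<le> 32"
      using Fc0 \<nu>4 by simp
    moreover have "t1\<^sup>2 + t2\<^sup>2 + t3\<^sup>2 \<le> 1/2" using T z by simp
    ultimately show ?thesis using P by argo
  qed
  moreover have q: "x\<^sup>2 = 0 \<and> x = 0 \<or> x\<^sup>2 = 1/4 \<and> \<bar>x\<bar> = 1/2" if "h x = 0" for x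
    using hz[OF that] square_of_abs_half[of x] by auto
  ultimately show "t1 = 0 \<and> \<bar>t2\<bar> = 1/2 \<and> \<bar>t3\<bar> = 1/2 \<or> \<bar>t1\<bar> = 1/2 \<and> t2 = 0 \<and> \<bar>t3\<bar> = 1/2
      \<or> \<bar>t1\<bar> = 1/2 \<and> \<bar>t2\<bar> = 1/2 \<and> t3 = 0"
    using q[OF z(1)] q[OF z(2)] q[OF z(3)] by (elim disjE conjE) simp_all
qed

text \<open>The listed vectors are, up to sign, the twelve minimal vectors of a face-centred cubic
  lattice. Its containment in \<open>L\<close> is what is recorded, since this suffices to find
  points of \<open>L\<close> near a line.\<close>

definition fcc_frame :: "(real^3) set \<Rightarrow> real^3 \<Rightarrow> real^3 \<Rightarrow> real^3 \<Rightarrow> bool" where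
  "fcc_frame L f g h \<longleftrightarrow>
     (\<forall>x\<in>L. \<forall>y\<in>L. x - y \<in> L) \<and>
     f \<bullet> f = 1 \<and> g \<bullet> g = 1 \<and> h \<bullet> h = 1 \<and> f \<bullet> g = 0 \<and> g \<bullet> h = 0 \<and> f \<bullet> h = 0 \<and>
     sqrt 2 *\<^sub>R (f + g) \<in> L \<and> sqrt 2 *\<^sub>R (f - g) \<in> L \<and>
     sqrt 2 *\<^sub>R (g + h) \<in> L \<and> sqrt 2 *\<^sub>R (g - h) \<in> L \<and>
     sqrt 2 *\<^sub>R (f + h) \<in> L \<and> sqrt 2 *\<^sub>R (f - h) \<in> L"

text \<open>After a sign change of \<open>x\<close>, the orthogonal vectors \<open>x\<close> and
  \<open>y\<close> become \<open>sqrt 2 *\<^sub>R (f + g)\<close> and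
  \<open>sqrt 2 *\<^sub>R (f - g)\<close>, and \<open>z\<close> becomes
  \<open>sqrt 2 *\<^sub>R (g + h)\<close>; these equations are solved for the frame.\<close>

lemma fcc_frameI:
  assumes cl: "\<And>x y. x \<in> L \<Longrightarrow> y \<in> L \<Longrightarrow> x - y \<in> L"
    and L: "x \<in> L" "y \<in> L" "z \<in> L"
    and n: "x \<bullet> x = 4" "y \<bullet> y = 4" "z \<bullet> z = 4" "x \<bullet> y = 0" "y \<bullet> z = -2" "\<bar>x \<bullet> z\<bar> = 2"
  shows "\<exists>f g h. fcc_frame L f g h"
proof -
  have neg: "- v \<in> L" if "v \<in> L" for v
    using cl[OF cl[OF that that] that] by simp
  obtain x where x: "x \<in> L" "x \<bullet> x = 4" "x \<bullet> y = 0" "x \<bullet> z = 2"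
  proof (cases "x \<bullet> z = 2")
    case True then show ?thesis using that L n by blast
  next
    case False
    then have "(- x) \<bullet> z = 2" using n by auto
    then show ?thesis using that[of "- x"] L n neg by simp
  qed
  have s2: "sqrt 2 * sqrt 2 = 2" by simp
  define c :: real where "c = inverse (2 * sqrt 2)"
  have c: "c * c = 1/8" "sqrt 2 * c = 1/2"
    using s2 by (simp_all add: c_def field_simps)
  define f g where fg: "f = c *\<^sub>R (x + y)" "g = c *\<^sub>R (x - y)"
  define h where "h = (2 * c) *\<^sub>R z - g"
  note ips = inner_add_left inner_add_right inner_diff_left inner_diff_right
  have com: "y \<bullet> x = 0" "z \<bullet> x = 2" "z \<bullet> y = -2"
    using x n by (simp_all add: inner_commute)
  have fz: "f \<bullet> z = 0" "g \<bullet> z = 4 * c" by (simp_all add: fg ips x n)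
  have ff: "f \<bullet> f = 1" "g \<bullet> g = 1" "f \<bullet> g = 0"
    using c by (simp_all add: fg ips x n com mult.assoc[symmetric])
  have fh: "f \<bullet> h = 0" "g \<bullet> h = 0"
    using c ff fz by (simp_all add: h_def ips)
  have "h \<bullet> h = ((2 * c) *\<^sub>R z - g) \<bullet> h" by (simp only: h_def)
  also have "\<dots> = (2 * c) * (z \<bullet> h)" using fh by (simp add: inner_diff_left)
  also have "z \<bullet> h = 4 * c"
    using fz by (simp add: h_def ips n inner_commute[of z g])
  finally have hh: "h \<bullet> h = 1" using c by simp
  have v: "sqrt 2 *\<^sub>R (f + g) = x" "sqrt 2 *\<^sub>R (f - g) = y" "sqrt 2 *\<^sub>R (g + h) = z"
  proof -
    have "f + g = (2 * c) *\<^sub>R x" "f - g = (2 * c) *\<^sub>R y" "g + h = (2 * c) *\<^sub>R z"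
      by (simp_all add: fg h_def vec_eq_iff algebra_simps)
    moreover have "sqrt 2 * (2 * c) = 1" using c by simp
    ultimately show "sqrt 2 *\<^sub>R (f + g) = x" "sqrt 2 *\<^sub>R (f - g) = y" "sqrt 2 *\<^sub>R (g + h) = z"
      by simp_all
  qed
  have "sqrt 2 *\<^sub>R (g - h) = (x - y) - z" "sqrt 2 *\<^sub>R (f + h) = y - - z" "sqrt 2 *\<^sub>R (f - h) = x - z"
    unfolding v[symmetric] by (simp_all add: algebra_simps)
  then have "fcc_frame L f g h"
    unfolding fcc_frame_def using ff fh hh v x L cl cl[OF L(2) neg[OF L(3)]] by simp
  then show ?thesis by blast
qed


text \<open>The squared determinant is \<open>d \<bullet> d\<close> times four times the squared
  area of the projected triangle, so the hypothesis is the equality case of Gauss' bound. It leaves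
  one \<open>x\<close> orthogonal to \<open>d\<close> and two with inner product 2 or -2;
  \<open>fcc_frameI\<close> is fed with \<open>d\<close>, the orthogonal one and another
  one.\<close>

lemma small_det_imp_fcc_frame:
  assumes pack: "lattice_packing L" and det: "(lattice_det L)\<^sup>2 \<le> 32"
  shows "\<exists>f g h. fcc_frame L f g h"
proof -
  obtain a b c where abc: "basis_of L a b c" "reduced_triple a b c"
    using exists_reduced_basis[OF pack] .
  \<comment> \<open>Reduced bases may be rotated, so a shortest of the three vectors can serve as
    \<open>d\<close>.\<close>
  have "\<exists>d a b. basis_of L d a b \<and> reduced_triple d a b \<and> d \<bullet> d \<le> a \<bullet> a \<and> d \<bullet> d \<le> b \<bullet> b"
  proof -
    consider "a \<bullet> a \<le> b \<bullet> b" "a \<bullet> a \<le> c \<bullet> c" | "b \<bullet> b \<le> a \<bullet> a" "b \<bullet> b \<le> c \<bullet> c"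
      | "c \<bullet> c \<le> a \<bullet> a" "c \<bullet> c \<le> b \<bullet> b" by linarith
    then show ?thesis
    proof cases
      case 1 then show ?thesis using abc by blast
    next
      case 2 then show ?thesis using abc basis_of_rotate reduced_rotate by blast
    next
      case 3 then show ?thesis using abc basis_of_rotate reduced_rotate by blast
    qed
  qed
  then obtain d a b where bas: "basis_of L d a b" and red: "reduced_triple d a b"
    and short: "d \<bullet> d \<le> a \<bullet> a" "d \<bullet> d \<le> b \<bullet> b" by blast
  obtain x1 x2 x3 \<kappa> where x: "basis_of L d x1 x2" "x1 + x2 + x3 = of_int \<kappa> *\<^sub>R d"
    "2 * \<bar>x1 \<bullet> d\<bar> \<le> d \<bullet> d" "2 * \<bar>x2 \<bullet> d\<bar> \<le> d \<bullet> d" "2 * \<bar>x3 \<bullet> d\<bar> \<le> d \<bullet> d"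
    "x1 \<bullet> x1 = a \<bullet> a" "x2 \<bullet> x2 = b \<bullet> b" "a \<bullet> a \<le> x3 \<bullet> x3"
    "2 * \<bar>x1 \<bullet> d\<bar> \<le> x1 \<bullet> x1" "2 * \<bar>x2 \<bullet> d\<bar> \<le> x2 \<bullet> x2"
    "\<kappa> = 0 \<and> 2 * \<bar>x3 \<bullet> d\<bar> \<le> x3 \<bullet> x3 \<or> \<bar>\<kappa>\<bar> = 1 \<and> d \<bullet> d \<le> x3 \<bullet> x3"
    and ob: "(d \<bullet> d) * (x1 \<bullet> x2) \<le> (x1 \<bullet> d) * (x2 \<bullet> d)"
    "(d \<bullet> d) * (x1 \<bullet> x3) \<le> (x1 \<bullet> d) * (x3 \<bullet> d)"
    "(d \<bullet> d) * (x2 \<bullet> x3) \<le> (x2 \<bullet> d) * (x3 \<bullet> d)"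
    by (rule projected_superbase[OF bas red])
  have mem: "d \<in> L" "x1 \<in> L" "x2 \<in> L" using basis_of_members[OF x(1)] by auto
  have cl: "v - w \<in> L" if "v \<in> L" "w \<in> L" for v w
    using basis_of_diff[OF x(1) that] .
  have "of_int \<kappa> *\<^sub>R d \<in> L" using basis_of_mem[OF x(1), of \<kappa> 0 0] by simp
  moreover have "x3 = of_int \<kappa> *\<^sub>R d - x1 - x2" unfolding x(2)[symmetric] by simp
  ultimately have mem3: "x3 \<in> L" using cl mem by simp
  have d4: "4 \<le> d \<bullet> d" and d: "d \<noteq> 0" "0 < d \<bullet> d"
    using lattice_packing_min_norm[OF pack mem(1)] basis_of_nonzero[OF x(1)] by auto
  define t where "t x = (x \<bullet> d) / (d \<bullet> d)" for x
  have t: "x \<bullet> d = t x * (d \<bullet> d)" for x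
    using d by (simp add: t_def)
  have ab2: "\<bar>t x\<bar> \<le> 1 / 2" if "2 * \<bar>x \<bullet> d\<bar> \<le> d \<bullet> d" for x
    using that d unfolding t_def by (simp add: field_simps)
  have "(t x1 + t x2 + t x3) * (d \<bullet> d) = (x1 + x2 + x3) \<bullet> d"
    using d by (simp add: t_def inner_add_left add_divide_distrib[symmetric])
  then have ts: "t x1 + t x2 + t x3 = of_int \<kappa>"
    using d unfolding x(2) by simp
  have ip: "perp d x \<bullet> perp d y = x \<bullet> y - t x * t y * (d \<bullet> d)" for x y
    using d by (simp add: t_def inner_perp)
  define w1 w2 w3 where w: "w1 = perp d x1" "w2 = perp d x2" "w3 = perp d x3"
  have "perp d (x1 + x2 + x3) = 0"
    unfolding x(2) by (simp add: perp_scaleR perp_self d)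
  then have w3: "w3 = - w1 - w2"
    by (simp add: w perp_add algebra_simps add_eq_0_iff)
  have ob': "perp d y \<bullet> perp d z \<le> 0" if "(d \<bullet> d) * (y \<bullet> z) \<le> (y \<bullet> d) * (z \<bullet> d)" for y z
    using that d by (simp add: inner_perp field_simps)
  have ob: "w1 \<bullet> w2 \<le> 0" "w1 \<bullet> w3 \<le> 0" "w2 \<bullet> w3 \<le> 0"
    using ob[THEN ob'] by (auto simp: w)
  have W3: "w3 \<bullet> w3 - w1 \<bullet> w1 - w2 \<bullet> w2 = 2 * (w1 \<bullet> w2)"
    by (simp add: w3 inner_diff_left inner_diff_right inner_commute)
  have W1: "w1 \<bullet> w1 - w2 \<bullet> w2 - w3 \<bullet> w3 = 2 * (w2 \<bullet> w3)"
    by (simp add: w3 inner_diff_left inner_diff_right inner_commute)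
  have W2: "w2 \<bullet> w2 - w1 \<bullet> w1 - w3 \<bullet> w3 = 2 * (w1 \<bullet> w3)"
    by (simp add: w3 inner_diff_left inner_diff_right inner_commute)
  have lower: "(d \<bullet> d) * (1 - (t x)\<^sup>2) \<le> perp d x \<bullet> perp d x" if "d \<bullet> d \<le> x \<bullet> x" for x
    using that by (simp add: ip power2_eq_square algebra_simps)
  \<comment> \<open>Subtracting multiples of \<open>d\<close> preserves the determinant, and
    afterwards the Gram determinant splits off the factor \<open>d \<bullet> d\<close>.\<close>
  have "det3 d w1 w2 = det3 d x1 x2"
    unfolding w perp_def det3_eq by (simp add: algebra_simps)
  then have "(lattice_det L)\<^sup>2 = (det3 d w1 w2)\<^sup>2"
    by (simp add: basis_of_det[OF x(1)])
  also have "\<dots> = (d \<bullet> d) * ((w1 \<bullet> w1) * (w2 \<bullet> w2) - (w1 \<bullet> w2)\<^sup>2)"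
  proof -
    have "d \<bullet> w1 = 0" "d \<bullet> w2 = 0"
      using inner_perp_axis[OF d(1)] by (simp_all add: w inner_commute[of d "perp d _"])
    then show ?thesis by (simp add: det3_square algebra_simps)
  qed
  \<comment> \<open>Multiplication by 4 turns 32 into 128 and the planar Gram determinant into
    Heron's expression.\<close>
  finally have "(d \<bullet> d) * (4 * (w1 \<bullet> w1) * (w2 \<bullet> w2) - (w3 \<bullet> w3 - w1 \<bullet> w1 - w2 \<bullet> w2)\<^sup>2) \<le> 128"
    using det unfolding W3 by (simp add: power_mult_distrib algebra_simps)
  note small = this
  have lo: "(d \<bullet> d) * (1 - (t x1)\<^sup>2) \<le> w1 \<bullet> w1" "(d \<bullet> d) * (1 - (t x2)\<^sup>2) \<le> w2 \<bullet> w2"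
      "(d \<bullet> d) * (1 - (t x3)\<^sup>2) \<le> w3 \<bullet> w3"
    unfolding w using short x(6-8) by (auto intro!: lower)
  have ac: "w1 \<bullet> w1 \<le> w2 \<bullet> w2 + w3 \<bullet> w3" "w2 \<bullet> w2 \<le> w1 \<bullet> w1 + w3 \<bullet> w3"
      "w3 \<bullet> w3 \<le> w1 \<bullet> w1 + w2 \<bullet> w2"
    using W1 W2 W3 ob by linarith+
  have sums: "t x1 + t x2 + t x3 = 0 \<or> \<bar>t x1 + t x2 + t x3\<bar> = 1"
    unfolding ts using x(11) by auto
  note gauss = gauss_inequality[OF d4 ab2[OF x(3)] ab2[OF x(4)] ab2[OF x(5)] sums lo ac small]
  note G = gauss(1-4) and T = gauss(5)
  have n: "x1 \<bullet> x1 = 4" "x2 \<bullet> x2 = 4" "x3 \<bullet> x3 = 4"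
    using G unfolding w ip by (simp_all add: power2_eq_square)
  have dx: "\<bar>d \<bullet> x\<bar> = 2" if "\<bar>t x\<bar> = 1/2" for x
    using that t[of x] G(1) by (simp add: inner_commute abs_mult)
  have dx0: "d \<bullet> x = 0" if "t x = 0" for x
    using that t[of x] by (simp add: inner_commute)
  show ?thesis
    using T
  proof (elim disjE conjE)
    \<comment> \<open>The squared projected edges are 4, 3, 3, with 4 for the vector orthogonal to
      \<open>d\<close>, which gives the inner product -2. It lifts unchanged because one of the
      coordinates along \<open>d\<close> is zero.\<close>
    assume s: "t x1 = 0" "\<bar>t x2\<bar> = 1/2" "\<bar>t x3\<bar> = 1/2"
    then have "w1 \<bullet> w2 = -2" using W3 G square_of_abs_half by simp
    then have "x1 \<bullet> x2 = -2" unfolding w ip s by simp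
    then show ?thesis
      using fcc_frameI[OF cl mem(1,2,3) G(1) n(1,2) dx0[OF s(1)] _ dx[OF s(2)]] by blast
  next
    assume s: "\<bar>t x1\<bar> = 1/2" "t x2 = 0" "\<bar>t x3\<bar> = 1/2"
    then have "w2 \<bullet> w1 = -2" using W3 G square_of_abs_half by (simp add: inner_commute)
    then have "x2 \<bullet> x1 = -2" unfolding w ip s by simp
    then show ?thesis
      using fcc_frameI[OF cl mem(1,3,2) G(1) n(2,1) dx0[OF s(2)] _ dx[OF s(1)]] by blast
  next
    assume s: "\<bar>t x1\<bar> = 1/2" "\<bar>t x2\<bar> = 1/2" "t x3 = 0"
    then have "w3 \<bullet> w1 = -2" using W2 G square_of_abs_half by (simp add: inner_commute)
    then have "x3 \<bullet> x1 = -2" unfolding w ip s by simp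
    then show ?thesis
      using fcc_frameI[OF cl mem(1) mem3 mem(2) G(1) n(3,1) dx0[OF s(3)] _ dx[OF s(1)]] by blast
  qed
qed

section \<open>Lines in the face-centred cubic lattice\<close>

text \<open>Up to the factor \<open>2 / U\<close>, the left side is the weighted sum of squared
  edges of a lattice triangle projected along the direction with coordinates \<alpha>, \<beta>,
  \<gamma>. The part \<open>E\<close> without \<gamma> is treated as a sum of squares; what remains
  is a square of \<gamma> with nonnegative coefficient and mixed terms of the right sign.\<close>

lemma fcc_inequality:
  fixes \<alpha> \<beta> \<gamma> l0 l1 l2 :: real
  assumes pos: "0 \<le> \<alpha>" "0 \<le> \<beta>" "0 \<le> \<gamma>" "0 < \<alpha>\<^sup>2 + \<beta>\<^sup>2"
    and l: "0 \<le> l0" "0 \<le> l1" "0 \<le> l2" "l0 + l1 + l2 = 1"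
  defines "U \<equiv> \<alpha>\<^sup>2 + \<beta>\<^sup>2 + \<gamma>\<^sup>2"
  shows "l0 * l1 * (2 * U - (\<beta> + \<gamma>)\<^sup>2) + l0 * l2 * (2 * U - (\<alpha> + \<gamma>)\<^sup>2)
      + l1 * l2 * (2 * U - (\<alpha> - \<beta>)\<^sup>2) \<le> 9 / 16 * U"
proof -
  define r where "r = \<alpha>\<^sup>2 + \<beta>\<^sup>2"
  define E where "E = 9 / 16 * r - (l0 * l1 * (2 * r - \<beta>\<^sup>2) + l0 * l2 * (2 * r - \<alpha>\<^sup>2)
      + l1 * l2 * (2 * r - (\<alpha> - \<beta>)\<^sup>2))"
  have l0: "l0 = 1 - l1 - l2" using l by simp
  \<comment> \<open>All squares vanish for \<open>\<alpha> = \<beta>\<close>,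
    \<open>l0 = 1/4\<close>, \<open>l1 = l2 = 3/8\<close>, the weights of
    \<open>circumcentre_far\<close>.\<close>
  have "r * E = (\<alpha>\<^sup>2 - \<beta>\<^sup>2)\<^sup>2 / 16 + r * ((l1 - 1/2) * \<alpha> - (l2 - 1/2) * \<beta>)\<^sup>2
      + ((l1 + l2 - 1/2) * r - \<alpha> * \<beta> / 2)\<^sup>2"
    unfolding E_def l0 r_def by (simp add: field_simps power2_eq_square)
  also have "\<dots> \<ge> 0" using pos by (simp add: r_def)
  finally have "0 \<le> E" using pos by (simp add: r_def zero_le_mult_iff)
  have "0 \<le> (l1 - l2)\<^sup>2 + (1 - l1 - l2)\<^sup>2" by simp
  then have "0 \<le> 9/16 - 2 * (l0 * l1 + l0 * l2 + l1 * l2) + l0 * l1 + l0 * l2"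
    by (simp add: l0 power2_eq_square algebra_simps)
  then have "0 \<le> (9/16 - 2 * (l0 * l1 + l0 * l2 + l1 * l2) + l0 * l1 + l0 * l2) * \<gamma>\<^sup>2"
    by simp
  moreover have "0 \<le> 2 * (l0 * l1) * (\<beta> * \<gamma>) + 2 * (l0 * l2) * (\<alpha> * \<gamma>)"
    using pos l by simp
  ultimately have "0 \<le> E + (9/16 - 2 * (l0 * l1 + l0 * l2 + l1 * l2) + l0 * l1 + l0 * l2) * \<gamma>\<^sup>2
      + (2 * (l0 * l1) * (\<beta> * \<gamma>) + 2 * (l0 * l2) * (\<alpha> * \<gamma>))"
    using \<open>0 \<le> E\<close> by simp
  also have "\<dots> = 9 / 16 * U - (l0 * l1 * (2 * U - (\<beta> + \<gamma>)\<^sup>2) + l0 * l2 * (2 * U - (\<alpha> + \<gamma>)\<^sup>2)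
      + l1 * l2 * (2 * U - (\<alpha> - \<beta>)\<^sup>2))"
    unfolding E_def r_def U_def by (simp add: power2_eq_square algebra_simps)
  finally show ?thesis by simp
qed

text \<open>By Leibniz' formula the weighted mean of the squared distances from \<open>Q\<close> to
  the vertices is the weighted sum of squared edges, so not all of them can exceed
  \<open>C\<close>.\<close>

lemma leibniz_near_vertex:
  fixes A B :: "'a :: real_inner"
  assumes l: "0 \<le> l0" "0 \<le> l1" "0 \<le> l2" "l0 + l1 + l2 = 1"
    and C: "l0 * l1 * (A \<bullet> A) + l0 * l2 * (B \<bullet> B) + l1 * l2 * ((A - B) \<bullet> (A - B)) \<le> C"
    and Q: "Q = l1 *\<^sub>R A + l2 *\<^sub>R B"
  shows "\<exists>X\<in>{0, A, B}. (X - Q) \<bullet> (X - Q) \<le> C"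
proof (rule ccontr)
  assume "\<not> ?thesis"
  then have f: "C < (0 - Q) \<bullet> (0 - Q)" "C < (A - Q) \<bullet> (A - Q)" "C < (B - Q) \<bullet> (B - Q)"
    by auto
  have l0: "l0 = 1 - l1 - l2" using l by simp
  have "l0 * ((0 - Q) \<bullet> (0 - Q)) + l1 * ((A - Q) \<bullet> (A - Q)) + l2 * ((B - Q) \<bullet> (B - Q))
      = l0 * l1 * (A \<bullet> A) + l0 * l2 * (B \<bullet> B) + l1 * l2 * ((A - B) \<bullet> (A - B))"
    unfolding Q l0
    by (simp add: inner_add_left inner_add_right inner_diff_left inner_diff_right
        inner_commute[of B A] algebra_simps)
  then have le: "l0 * ((0 - Q) \<bullet> (0 - Q) - C) + l1 * ((A - Q) \<bullet> (A - Q) - C)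
      + l2 * ((B - Q) \<bullet> (B - Q) - C) \<le> 0"
  proof -
    have "l0 * (x - C) + l1 * (y - C) + l2 * (z - C) = (l0 * x + l1 * y + l2 * z) - (l0 + l1 + l2) * C"
      for x y z by (simp add: algebra_simps)
    then show ?thesis using C l(4) \<open>_ = l0 * l1 * (A \<bullet> A) + _ + _\<close> by simp
  qed
  have nn: "0 \<le> l0 * ((0 - Q) \<bullet> (0 - Q) - C)" "0 \<le> l1 * ((A - Q) \<bullet> (A - Q) - C)"
      "0 \<le> l2 * ((B - Q) \<bullet> (B - Q) - C)"
    using f l by simp_all
  then have "l0 * ((0 - Q) \<bullet> (0 - Q) - C) = 0" "l1 * ((A - Q) \<bullet> (A - Q) - C) = 0"
      "l2 * ((B - Q) \<bullet> (B - Q) - C) = 0"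
    using le by linarith+
  then have "l0 = 0" "l1 = 0" "l2 = 0" using f by auto
  then show False using l by simp
qed


section \<open>Symmetries and coordinates of a face-centred cubic frame\<close>

lemma fcc_frame_swap: "fcc_frame L f g h \<Longrightarrow> fcc_frame L g f h"
  and fcc_frame_rotate: "fcc_frame L f g h \<Longrightarrow> fcc_frame L g h f"
  and fcc_frame_uminus: "fcc_frame L f g h \<Longrightarrow> fcc_frame L (- f) g h"
proof -
  assume F: "fcc_frame L f g h"
  then have cl: "x - y \<in> L" if "x \<in> L" "y \<in> L" for x y
    using that by (auto simp: fcc_frame_def)
  have neg: "- v \<in> L" if "v \<in> L" for v
    using cl[OF cl[OF that that] that] by simp
  have L: "sqrt 2 *\<^sub>R (f + g) \<in> L" "sqrt 2 *\<^sub>R (f - g) \<in> L"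
     "sqrt 2 *\<^sub>R (g + h) \<in> L" "sqrt 2 *\<^sub>R (g - h) \<in> L"
     "sqrt 2 *\<^sub>R (f + h) \<in> L" "sqrt 2 *\<^sub>R (f - h) \<in> L"
    and o: "f \<bullet> f = 1" "g \<bullet> g = 1" "h \<bullet> h = 1" "f \<bullet> g = 0" "g \<bullet> h = 0" "f \<bullet> h = 0"
      "g \<bullet> f = 0" "h \<bullet> g = 0" "h \<bullet> f = 0"
    using F by (auto simp: fcc_frame_def inner_commute)
  have "- (sqrt 2 *\<^sub>R (f - g)) = sqrt 2 *\<^sub>R (g - f)" "- (sqrt 2 *\<^sub>R (f - h)) = sqrt 2 *\<^sub>R (h - f)"
    "- (sqrt 2 *\<^sub>R (f + g)) = sqrt 2 *\<^sub>R (- f - g)" "- (sqrt 2 *\<^sub>R (f + h)) = sqrt 2 *\<^sub>R (- f - h)"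
    by (simp_all add: algebra_simps)
  then have N: "sqrt 2 *\<^sub>R (g - f) \<in> L" "sqrt 2 *\<^sub>R (h - f) \<in> L"
    "sqrt 2 *\<^sub>R (- f - g) \<in> L" "sqrt 2 *\<^sub>R (- f - h) \<in> L"
    using L neg by metis+
  show "fcc_frame L g f h" "fcc_frame L g h f" "fcc_frame L (- f) g h"
    unfolding fcc_frame_def using cl L N o by (simp_all add: add.commute)
qed

lemma fcc_frame_expand:
  assumes "fcc_frame L f g h"
  shows "v = (v \<bullet> f) *\<^sub>R f + (v \<bullet> g) *\<^sub>R g + (v \<bullet> h) *\<^sub>R h"
proof -
  have o: "f \<bullet> f = 1" "g \<bullet> g = 1" "h \<bullet> h = 1" "f \<bullet> g = 0" "g \<bullet> h = 0" "f \<bullet> h = 0"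
      "g \<bullet> f = 0" "h \<bullet> g = 0" "h \<bullet> f = 0"
    using assms by (auto simp: fcc_frame_def inner_commute)
  have "(det3 f g h)\<^sup>2 = 1" by (simp add: det3_square o)
  then have "det3 f g h \<noteq> 0" by auto
  then have "v - ((v \<bullet> f) *\<^sub>R f + (v \<bullet> g) *\<^sub>R g + (v \<bullet> h) *\<^sub>R h) = 0"
    by (rule orthogonal_to_basis) (simp_all add: inner_diff_left inner_add_left o)
  then show ?thesis by simp
qed

text \<open>Alternating sign changes of the first vector with rotations makes all coordinates of
  \<open>u\<close> nonnegative; swaps and rotations then sort them.\<close>

lemma fcc_frame_sorted:
  assumes "fcc_frame L f g h"
  shows "\<exists>f g h. fcc_frame L f g h \<and> u \<bullet> g \<le> u \<bullet> f \<and> u \<bullet> h \<le> u \<bullet> g \<and> 0 \<le> u \<bullet> h"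
proof -
  have pos: "\<exists>f'. fcc_frame L f' g h \<and> 0 \<le> u \<bullet> f'" if "fcc_frame L f g h" for f g h
  proof (cases "0 \<le> u \<bullet> f")
    case True then show ?thesis using that by blast
  next
    case False
    then have "0 \<le> u \<bullet> (- f)" by simp
    then show ?thesis using fcc_frame_uminus[OF that] by blast
  qed
  obtain f' where "fcc_frame L f' g h" "0 \<le> u \<bullet> f'" using pos assms by blast
  moreover from this obtain g' where "fcc_frame L g' h f'" "0 \<le> u \<bullet> g'"
    using pos fcc_frame_rotate by blast
  moreover from this obtain h' where "fcc_frame L h' f' g'" "0 \<le> u \<bullet> h'"
    using pos fcc_frame_rotate by blast
  ultimately obtain f g h where F: "fcc_frame L f g h" and p: "0 \<le> u \<bullet> f" "0 \<le> u \<bullet> g" "0 \<le> u \<bullet> h"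
    by blast
  have G: "fcc_frame L g h f" "fcc_frame L h f g"
    using F fcc_frame_rotate by blast+
  consider "u \<bullet> g \<le> u \<bullet> f" "u \<bullet> h \<le> u \<bullet> g" | "u \<bullet> h \<le> u \<bullet> f" "u \<bullet> g \<le> u \<bullet> h"
    | "u \<bullet> f \<le> u \<bullet> g" "u \<bullet> h \<le> u \<bullet> f" | "u \<bullet> h \<le> u \<bullet> g" "u \<bullet> f \<le> u \<bullet> h"
    | "u \<bullet> f \<le> u \<bullet> h" "u \<bullet> g \<le> u \<bullet> f" | "u \<bullet> g \<le> u \<bullet> h" "u \<bullet> f \<le> u \<bullet> g"
    by linarith
  then show ?thesis
  proof cases
    case 1 then show ?thesis using F p by blast
  next
    case 2 then show ?thesis using fcc_frame_rotate[OF fcc_frame_swap[OF F]] p by blast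
  next
    case 3 then show ?thesis using fcc_frame_swap[OF F] p by blast
  next
    case 4 then show ?thesis using G p by blast
  next
    case 5 then show ?thesis using G p by blast
  next
    case 6 then show ?thesis using fcc_frame_swap[OF G(1)] p by blast
  qed
qed

lemma fcc_triangle:
  assumes F: "fcc_frame L f g h" and u: "u \<noteq> 0"
    and s: "u \<bullet> g \<le> u \<bullet> f" "u \<bullet> h \<le> u \<bullet> g" "0 \<le> u \<bullet> h"
    and l: "0 \<le> l1" "0 \<le> l2" "l1 + l2 \<le> 1"
    and ab: "a = sqrt 2 *\<^sub>R (g + h)" "b = sqrt 2 *\<^sub>R (f + h)"
  shows "\<exists>X\<in>{0, a, b}. perp u (X - (l1 *\<^sub>R a + l2 *\<^sub>R b)) \<bullet> perp u (X - (l1 *\<^sub>R a + l2 *\<^sub>R b)) \<le> 9/8"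
proof -
  have o: "f \<bullet> f = 1" "g \<bullet> g = 1" "h \<bullet> h = 1" "f \<bullet> g = 0" "g \<bullet> h = 0" "f \<bullet> h = 0"
      "g \<bullet> f = 0" "h \<bullet> g = 0" "h \<bullet> f = 0"
    using F by (auto simp: fcc_frame_def inner_commute)
  define \<alpha> \<beta> \<gamma> where abc: "\<alpha> = u \<bullet> f" "\<beta> = u \<bullet> g" "\<gamma> = u \<bullet> h"
  define U where "U = \<alpha>\<^sup>2 + \<beta>\<^sup>2 + \<gamma>\<^sup>2"
  have ue: "u = \<alpha> *\<^sub>R f + \<beta> *\<^sub>R g + \<gamma> *\<^sub>R h"
    unfolding abc by (rule fcc_frame_expand[OF F])
  have uu: "u \<bullet> u = U"
    by (subst (2) ue) (simp add: U_def inner_add_right abc power2_eq_square)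
  have U: "0 < U" using u by (simp add: uu[symmetric])
  have pos: "0 \<le> \<gamma>" "\<gamma> \<le> \<beta>" "\<beta> \<le> \<alpha>" using s by (simp_all add: abc)
  have "\<alpha> \<noteq> 0"
  proof
    assume "\<alpha> = 0"
    then have "\<beta> = 0" "\<gamma> = 0" using pos by auto
    then show False using \<open>\<alpha> = 0\<close> U by (simp add: U_def)
  qed
  then have pos2: "0 < \<alpha>\<^sup>2 + \<beta>\<^sup>2" by (simp add: sum_power2_gt_zero_iff)
  have d: "a \<bullet> a = 4" "b \<bullet> b = 4" "(a - b) \<bullet> (a - b) = 4"
    by (simp_all add: ab o inner_add_left inner_add_right inner_diff_left inner_diff_right)
  have du: "(a \<bullet> u) * (a \<bullet> u) = 2 * (\<beta> + \<gamma>)\<^sup>2" "(b \<bullet> u) * (b \<bullet> u) = 2 * (\<alpha> + \<gamma>)\<^sup>2"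
    "((a - b) \<bullet> u) * ((a - b) \<bullet> u) = 2 * (\<alpha> - \<beta>)\<^sup>2"
    by (simp_all add: ab abc inner_commute[of _ u] inner_add_right inner_diff_right
        power2_eq_square algebra_simps)
  \<comment> \<open>Projection along \<open>u\<close> lowers the squared edge 4 by the squared
    component along \<open>u\<close>; this form matches \<open>fcc_inequality\<close>.\<close>
  have sc: "4 - 2 * x / U = 2 / U * (2 * U - x)" for x
    using U by (simp add: field_simps)
  define l0 where "l0 = 1 - l1 - l2"
  have l0: "0 \<le> l0" "l0 + l1 + l2 = 1" using l by (simp_all add: l0_def)
  have "\<exists>X\<in>{0, perp u a, perp u b}. (X - perp u (l1 *\<^sub>R a + l2 *\<^sub>R b)) \<bullet> (X - perp u (l1 *\<^sub>R a + l2 *\<^sub>R b)) \<le> 9/8"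
  proof (rule leibniz_near_vertex[OF l0(1) l(1,2) l0(2)])
    have "l0 * l1 * (perp u a \<bullet> perp u a) + l0 * l2 * (perp u b \<bullet> perp u b)
        + l1 * l2 * ((perp u a - perp u b) \<bullet> (perp u a - perp u b))
      = 2 / U * (l0 * l1 * (2 * U - (\<beta> + \<gamma>)\<^sup>2) + l0 * l2 * (2 * U - (\<alpha> + \<gamma>)\<^sup>2)
          + l1 * l2 * (2 * U - (\<alpha> - \<beta>)\<^sup>2))"
      unfolding perp_diff[symmetric] inner_perp[OF u] d du uu sc by (simp add: algebra_simps)
    also have "\<dots> \<le> 2 / U * (9 / 16 * U)"
      using fcc_inequality[of \<alpha> \<beta> \<gamma> l0 l1 l2] pos pos2 l l0 U
      by (intro mult_left_mono) (auto simp: U_def)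
    also have "\<dots> = 9/8" using U by simp
    finally show "l0 * l1 * (perp u a \<bullet> perp u a) + l0 * l2 * (perp u b \<bullet> perp u b)
        + l1 * l2 * ((perp u a - perp u b) \<bullet> (perp u a - perp u b)) \<le> 9/8" .
  qed (simp add: perp_add perp_scaleR)
  moreover have "perp u 0 = 0" by (simp add: perp_def)
  ultimately show ?thesis unfolding perp_diff by auto
qed

lemma line_near_fcc:
  assumes F: "fcc_frame L f g h" and u: "u \<noteq> 0"
  shows "\<exists>x\<in>L. \<exists>t. (x - p - t *\<^sub>R u) \<bullet> (x - p - t *\<^sub>R u) \<le> 9/8"
proof -
  obtain f g h where F: "fcc_frame L f g h" and s: "u \<bullet> g \<le> u \<bullet> f" "u \<bullet> h \<le> u \<bullet> g" "0 \<le> u \<bullet> h"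
    using fcc_frame_sorted[OF F, of u] by blast
  have o: "f \<bullet> f = 1" "g \<bullet> g = 1" "h \<bullet> h = 1" "f \<bullet> g = 0" "g \<bullet> h = 0" "f \<bullet> h = 0"
      "g \<bullet> f = 0" "h \<bullet> g = 0" "h \<bullet> f = 0"
    using F by (auto simp: fcc_frame_def inner_commute)
  have cl: "x - y \<in> L" if "x \<in> L" "y \<in> L" for x y
    using that F by (auto simp: fcc_frame_def)
  define a b where ab: "a = sqrt 2 *\<^sub>R (g + h)" "b = sqrt 2 *\<^sub>R (f + h)"
  have abL: "a \<in> L" "b \<in> L" using F by (auto simp: ab fcc_frame_def)
  have zero: "0 \<in> L" using cl[OF abL(1) abL(1)] by simp
  have add: "x + y \<in> L" if "x \<in> L" "y \<in> L" for x y
    using cl[OF that(1) cl[OF zero that(2)]] by simp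
  have natL: "of_nat k *\<^sub>R x \<in> L" if "x \<in> L" for k x
    by (induction k) (auto simp: zero scaleR_add_left intro!: add that)
  have intL: "of_int k *\<^sub>R x \<in> L" if "x \<in> L" for k x
  proof (cases k rule: int_cases2)
    case (nonneg n) then show ?thesis using natL[OF that] by simp
  next
    case (nonpos n)
    then show ?thesis using cl[OF zero natL[OF that, of n]] by simp
  qed
  \<comment> \<open>\<open>n\<close> is normal to the plane of \<open>a\<close> and
    \<open>b\<close>. By the sorting, \<open>u \<bullet> n\<close> is at least
    \<open>u \<bullet> f\<close>, which is positive, so the line crosses the plane, namely at
    \<open>P\<close>.\<close>
  define n where "n = f + g - h"
  have "u \<bullet> f \<noteq> 0"
  proof
    assume "u \<bullet> f = 0"
    then have "u \<bullet> f = 0" "u \<bullet> g = 0" "u \<bullet> h = 0" using s by auto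
    then show False using fcc_frame_expand[OF F, of u] u by simp
  qed
  then have un: "u \<bullet> n \<noteq> 0" using s by (simp add: n_def inner_add_right inner_diff_right)
  define \<tau> where "\<tau> = - (p \<bullet> n) / (u \<bullet> n)"
  define P where "P = p + \<tau> *\<^sub>R u"
  have "P \<bullet> n = 0" using un by (simp add: P_def \<tau>_def inner_add_left inner_diff_left)
  then have "P \<bullet> h = P \<bullet> f + P \<bullet> g" by (simp add: n_def inner_add_right inner_diff_right)
  then have Pe: "P = ((P \<bullet> g) / sqrt 2) *\<^sub>R a + ((P \<bullet> f) / sqrt 2) *\<^sub>R b"
    using fcc_frame_expand[OF F, of P] by (simp add: ab algebra_simps)
  define i j where ij: "i = \<lfloor>(P \<bullet> g) / sqrt 2\<rfloor>" "j = \<lfloor>(P \<bullet> f) / sqrt 2\<rfloor>"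
  define l m where lm: "l = frac ((P \<bullet> g) / sqrt 2)" "m = frac ((P \<bullet> f) / sqrt 2)"
  have lm0: "0 \<le> l" "l \<le> 1" "0 \<le> m" "m \<le> 1"
    unfolding lm by (simp_all add: less_imp_le frac_lt_1)
  define X where "X = of_int i *\<^sub>R a + of_int j *\<^sub>R b"
  have XL: "X \<in> L" by (simp add: X_def add intL abL)
  have PX: "P = X + (l *\<^sub>R a + m *\<^sub>R b)"
    by (subst Pe) (simp add: X_def lm ij frac_def algebra_simps)
  \<comment> \<open>The line passes through \<open>P\<close> in direction \<open>u\<close>, so
    nearness may be tested after projection.\<close>
  have fin: ?thesis if "x \<in> L" "perp u (x - P) \<bullet> perp u (x - P) \<le> 9/8" for x
  proof -
    have "perp u (x - P) = x - p - (\<tau> + ((x - P) \<bullet> u) / (u \<bullet> u)) *\<^sub>R u"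
      by (simp add: perp_def P_def algebra_simps)
    then show ?thesis using that by metis
  qed
  have sym: "perp u (x - y) \<bullet> perp u (x - y) = perp u (y - x) \<bullet> perp u (y - x)" for x y
    by (simp add: perp_diff inner_diff_left inner_diff_right inner_commute)
  show ?thesis
  proof (cases "l + m \<le> 1")
    case True
    obtain Y where Y: "Y \<in> {0, a, b}"
      "perp u (Y - (l *\<^sub>R a + m *\<^sub>R b)) \<bullet> perp u (Y - (l *\<^sub>R a + m *\<^sub>R b)) \<le> 9/8"
      using fcc_triangle[OF F u s lm0(1,3) True ab] by blast
    have "X + Y \<in> L" using Y(1) XL abL add zero by auto
    moreover have "X + Y - P = Y - (l *\<^sub>R a + m *\<^sub>R b)" by (simp add: PX)
    ultimately show ?thesis using fin[of "X + Y"] Y(2) by (simp only:)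
  next
    case False
    obtain Y where Y: "Y \<in> {0, a, b}"
      "perp u (Y - ((1 - l) *\<^sub>R a + (1 - m) *\<^sub>R b)) \<bullet> perp u (Y - ((1 - l) *\<^sub>R a + (1 - m) *\<^sub>R b)) \<le> 9/8"
    proof -
      have "0 \<le> 1 - l" "0 \<le> 1 - m" "(1 - l) + (1 - m) \<le> 1" using lm0 False by auto
      then show ?thesis using fcc_triangle[OF F u s _ _ _ ab] that by blast
    qed
    \<comment> \<open>The other half of the lattice parallelogram is the point reflection of the
      first, which sends the vertex \<open>Y\<close> to \<open>X + a + b - Y\<close>.\<close>
    have "X + a + b - Y \<in> L" using Y(1) XL abL add cl zero by auto
    moreover have "X + a + b - Y - P = ((1 - l) *\<^sub>R a + (1 - m) *\<^sub>R b) - Y"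
      by (simp add: PX algebra_simps)
    ultimately show ?thesis using fin[of "X + a + b - Y"] Y(2) sym by metis
  qed
qed

section \<open>Free cylinders\<close>

lemma critical_radius_square: "(1 + (3 * sqrt 2 / 4 - 1))\<^sup>2 = 9/8"
  by (simp add: power2_eq_square)

lemma critical_radius_pos: "0 < 3 * sqrt 2 / 4 - 1"
proof -
  have "4/3 < sqrt 2" by (rule real_less_rsqrt) (simp add: power2_eq_square)
  then show ?thesis by simp
qed

text \<open>A common point of cylinder and ball would put an axis point at distance below
  \<open>1 + r\<close> from a centre.\<close>

lemma free_cylinderI:
  assumes r: "0 < r"
    and far: "\<And>x t. x \<in> L \<Longrightarrow> (1 + r)\<^sup>2 \<le> (x - p - t *\<^sub>R u) \<bullet> (x - p - t *\<^sub>R u)"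
  shows "open_cylinder p u r \<inter> ball_union L = {}"
proof (rule ccontr)
  assume "\<not> ?thesis"
  then obtain x y where y: "infdist y (axis_line p u) < r" and x: "x \<in> L" "dist x y \<le> 1"
    by (auto simp: open_cylinder_def ball_union_def)
  have ne: "axis_line p u \<noteq> {}" by (simp add: axis_line_def)
  have "\<exists>t. dist y (p + t *\<^sub>R u) < r"
  proof (rule ccontr)
    assume "\<not> ?thesis"
    then have "r \<le> dist y q" if "q \<in> axis_line p u" for q
      using that by (auto simp: axis_line_def not_less)
    then have "r \<le> infdist y (axis_line p u)"
      using ne by (simp add: infdist_notempty cINF_greatest)
    then show False using y by simp
  qed
  then obtain t where t: "dist y (p + t *\<^sub>R u) < r" ..
  have "(1 + r)\<^sup>2 \<le> (dist x (p + t *\<^sub>R u))\<^sup>2"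
    using far[OF x(1), of t] by (simp add: dist_norm power2_norm_eq_inner algebra_simps)
  then have "1 + r \<le> dist x (p + t *\<^sub>R u)"
    by (rule power2_le_imp_le) simp
  also have "\<dots> \<le> dist x y + dist y (p + t *\<^sub>R u)" by (rule dist_triangle)
  finally show False using x t by simp
qed

text \<open>Moving from the centre \<open>x\<close> towards the near axis point, but by at most 1,
  stays in the ball and comes within \<open>r\<close> of the axis.\<close>

lemma not_free_cylinder:
  assumes near: "x \<in> L" "dist x (p + t *\<^sub>R u) < 1 + r" and r: "0 < r"
  shows "open_cylinder p u r \<inter> ball_union L \<noteq> {}"
proof -
  define q where "q = p + t *\<^sub>R u"
  have q: "q \<in> axis_line p u" unfolding q_def axis_line_def by blast
  obtain y where y: "dist x y \<le> 1" "dist y q < r"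
  proof (cases "dist x q \<le> 1")
    case True then show ?thesis using that[of q] r by simp
  next
    case False
    define D where "D = dist x q"
    have D: "1 < D" "D < 1 + r" "norm (q - x) = D"
      using False near by (simp_all add: D_def q_def dist_norm norm_minus_commute)
    define y where "y = x + (1 / D) *\<^sub>R (q - x)"
    have "y - q = (1 / D - 1) *\<^sub>R (q - x)"
      by (simp add: y_def algebra_simps)
    then have "dist y q = \<bar>1 / D - 1\<bar> * D" using D by (simp add: dist_norm)
    moreover have "\<bar>1 / D - 1\<bar> = 1 - 1 / D" using D by simp
    ultimately have "dist y q = D - 1" using D by (simp add: left_diff_distrib)
    moreover have "dist x y = 1" using D by (simp add: y_def dist_norm)
    ultimately show ?thesis using that[of y] D by simp
  qed
  have "infdist y (axis_line p u) < r"
    using infdist_le[OF q, of y] y by simp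
  then have "y \<in> open_cylinder p u r \<inter> ball_union L"
    using y near(1) by (auto simp: open_cylinder_def ball_union_def)
  then show ?thesis by blast
qed

lemma no_free_cylinder_of_small_det:
  assumes "lattice_packing L" "(lattice_det L)\<^sup>2 \<le> 32" "r > 3 * sqrt 2 / 4 - 1"
  shows "\<not> has_free_cylinder L r"
proof -
  obtain f g h where F: "fcc_frame L f g h"
    using small_det_imp_fcc_frame assms by blast
  have r: "0 < r" using assms critical_radius_pos by simp
  have "open_cylinder p u r \<inter> ball_union L \<noteq> {}" if u: "u \<noteq> 0" for p u
  proof -
    obtain x t where x: "x \<in> L" "(x - p - t *\<^sub>R u) \<bullet> (x - p - t *\<^sub>R u) \<le> 9/8"
      using line_near_fcc[OF F u] by blast
    have "(dist x (p + t *\<^sub>R u))\<^sup>2 \<le> (1 + (3 * sqrt 2 / 4 - 1))\<^sup>2"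
      unfolding critical_radius_square using x(2)
      by (simp add: dist_norm power2_norm_eq_inner algebra_simps)
    then have "dist x (p + t *\<^sub>R u) \<le> 1 + (3 * sqrt 2 / 4 - 1)"
      by (rule power2_le_imp_le) simp
    then show ?thesis using assms r by (intro not_free_cylinder[OF x(1), of p t u]) auto
  qed
  then show ?thesis by (auto simp: has_free_cylinder_def)
qed

lemma three_free_cylinders:
  assumes "lattice_packing L"
  shows "has_three_free_cylinders L (3 * sqrt 2 / 4 - 1)"
proof -
  obtain a b c where B: "basis_of L a b c" and R: "reduced_triple a b c"
    using exists_reduced_basis[OF assms] .
  have *: "\<exists>p. open_cylinder p d (3 * sqrt 2 / 4 - 1) \<inter> ball_union L = {}"
    if bas: "basis_of L d x y" and red: "reduced_triple d x y" for d x y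
  proof -
    obtain p where "\<forall>x\<in>L. \<forall>t. 9 / 8 \<le> (x - p - t *\<^sub>R d) \<bullet> (x - p - t *\<^sub>R d)"
      using line_far_from_lattice[OF bas red lattice_packing_min_norm[OF assms]] by blast
    then have "open_cylinder p d (3 * sqrt 2 / 4 - 1) \<inter> ball_union L = {}"
      by (intro free_cylinderI[OF critical_radius_pos]) (simp only: critical_radius_square)
    then show ?thesis by blast
  qed
  have B': "basis_of L b c a" "basis_of L c a b" and R': "reduced_triple b c a" "reduced_triple c a b"
    using B R basis_of_rotate reduced_rotate by blast+
  show ?thesis
    unfolding has_three_free_cylinders_def
    using *[OF B R] *[OF B'(1) R'(1)] *[OF B'(2) R'(2)] basis_of_independent[OF B] by blast
qed

lemma exists_fcc_packing: "\<exists>M. lattice_packing M \<and> (lattice_det M)\<^sup>2 = 32"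
proof -
  define a b c :: "real^3" where abc: "a = vector [0, sqrt 2, sqrt 2]" "b = vector [sqrt 2, 0, sqrt 2]"
    "c = vector [sqrt 2, sqrt 2, 0]"
  define M where "M = int_span a b c"
  have d: "det3 a b c = 4 * sqrt 2" by (simp add: det3_eq abc)
  then have B: "basis_of M a b c" by (simp add: basis_of_def M_def)
  have min: "4 \<le> x \<bullet> x" if x: "x \<in> M" "x \<noteq> 0" for x
  proof -
    obtain i j k :: int where ijk: "x = of_int i *\<^sub>R a + of_int j *\<^sub>R b + of_int k *\<^sub>R c"
      using x by (auto simp: M_def int_span_def)
    \<comment> \<open>The three sums have an even total, hence so do their squares; for nonzero
      \<open>x\<close> they do not all vanish.\<close>
    have "2 \<le> (j + k)\<^sup>2 + (i + k)\<^sup>2 + (i + j)\<^sup>2"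
    proof -
      have "even ((j + k)\<^sup>2 + (i + k)\<^sup>2 + (i + j)\<^sup>2)"
        by (cases "even i"; cases "even j"; cases "even k") simp_all
      moreover have "(j + k)\<^sup>2 + (i + k)\<^sup>2 + (i + j)\<^sup>2 \<noteq> 0"
      proof
        assume "(j + k)\<^sup>2 + (i + k)\<^sup>2 + (i + j)\<^sup>2 = 0"
        then have "j + k = 0" "i + k = 0" "i + j = 0"
          by (simp_all add: add_nonneg_eq_0_iff)
        then have "i = 0" "j = 0" "k = 0" by presburger+
        then show False using x ijk by simp
      qed
      moreover have "0 \<le> (j + k)\<^sup>2 + (i + k)\<^sup>2 + (i + j)\<^sup>2" by simp
      moreover have "2 \<le> n" if "even n" "n \<noteq> 0" "0 \<le> n" for n :: int
        using that by presburger
      ultimately show ?thesis by blast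
    qed
    then have "real_of_int 2 \<le> of_int ((j + k)\<^sup>2 + (i + k)\<^sup>2 + (i + j)\<^sup>2)"
      by (simp only: of_int_le_iff)
    moreover have "x \<bullet> x = 2 * of_int ((j + k)\<^sup>2 + (i + k)\<^sup>2 + (i + j)\<^sup>2)"
      by (simp add: inner_3 ijk abc power2_eq_square algebra_simps)
    ultimately show ?thesis by simp
  qed
  have "interior (cball x 1) \<inter> interior (cball y 1) = {}" if "x \<in> M" "y \<in> M" "x \<noteq> y" for x y
  proof -
    have "2\<^sup>2 \<le> (dist x y)\<^sup>2"
      using that min[OF basis_of_diff[OF B that(1,2)]]
      by (simp add: dist_norm power2_norm_eq_inner)
    then have "2 \<le> dist x y" by (rule power2_le_imp_le) simp
    then show ?thesis by (simp add: disjoint_ballI)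
  qed
  then have "lattice_packing M"
    using basis_of_lattice_basis[OF B] by (auto simp: lattice_packing_def is_lattice_def)
  moreover have "(lattice_det M)\<^sup>2 = 32"
    by (simp add: basis_of_det[OF B] d power_mult_distrib)
  ultimately show ?thesis by blast
qed

text \<open>Density is inversely proportional to the determinant, so the face-centred cubic packing
  serves as a comparison.\<close>

lemma densest_det_le:
  assumes "densest_lattice_packing L"
  shows "(lattice_det L)\<^sup>2 \<le> 32"
proof -
  obtain M where M: "lattice_packing M" "(lattice_det M)\<^sup>2 = 32"
    using exists_fcc_packing by blast
  have pos: "0 < lattice_det K" if K: "lattice_packing K" for K
  proof -
    obtain B where "lattice_basis B K" using K by (auto simp: lattice_packing_def is_lattice_def)
    then show ?thesis by (simp add: lattice_det_eq) (simp add: lattice_basis_def invertible_det_nz)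
  qed
  have L: "lattice_packing L" "packing_density M \<le> packing_density L"
    using assms M by (auto simp: densest_lattice_packing_def)
  have "0 < measure lebesgue (cball (0 :: real^3) 1)"
    using content_cball_pos[of 1 "0 :: real^3"] by simp
  then have "lattice_det L \<le> lattice_det M"
    using L(2) pos[OF M(1)] pos[OF L(1)] by (simp add: packing_density_def field_simps)
  then have "(lattice_det L)\<^sup>2 \<le> (lattice_det M)\<^sup>2"
    using pos[OF L(1)] by (intro power_mono) auto
  then show ?thesis using M by simp
qed

theorem mainTheorem7:
  "(\<forall>L. densest_lattice_packing L \<longrightarrow>
      \<not> (\<exists>r. r > 3 * sqrt 2 / 4 - 1 \<and> has_free_cylinder L r)) \<and>
   (\<forall>L. lattice_packing L \<longrightarrow> has_three_free_cylinders L (3 * sqrt 2 / 4 - 1)) \<and>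
   (\<forall>r > 3 * sqrt 2 / 4 - 1. \<not> (\<forall>L. lattice_packing L \<longrightarrow> has_free_cylinder L r))"
proof (intro conjI)
  show "\<forall>L. densest_lattice_packing L \<longrightarrow>
      \<not> (\<exists>r. r > 3 * sqrt 2 / 4 - 1 \<and> has_free_cylinder L r)"
    using no_free_cylinder_of_small_det densest_det_le
    unfolding densest_lattice_packing_def by blast
  show "\<forall>L. lattice_packing L \<longrightarrow> has_three_free_cylinders L (3 * sqrt 2 / 4 - 1)"
    using three_free_cylinders by blast
  \<comment> \<open>The face-centred cubic packing is the counterexample for every such
    \<open>r\<close>.\<close>
  show "\<forall>r > 3 * sqrt 2 / 4 - 1. \<not> (\<forall>L. lattice_packing L \<longrightarrow> has_free_cylinder L r)"
    using no_free_cylinder_of_small_det exists_fcc_packing by (metis order_refl)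
qed

end
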